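(* Let $a,b$ be positive integers with $a\le b$ and let $f^{a,b}_3(x,y,z,w)=ax^2+by^2+3(z^2+zw+w^2)$. If $f^{a,b}_3$ represents $1$, $2$ and $6$ (with integer arguments), then it represents every nonnegative integer. *)

theory Defs
  imports Main
begin

definition f3 :: "int \<Rightarrow> int \<Rightarrow> int \<Rightarrow> int \<Rightarrow> int \<Rightarrow> int \<Rightarrow> int" where
  "f3 a b x y z w = a * x^2 + b * y^2 + 3 * (z^2 + z * w + w^2)"

definition represents3 :: "int \<Rightarrow> int \<Rightarrow> int \<Rightarrow> bool" where
  "represents3 a b n \<longleftrightarrow> (\<exists>x y z w. f3 a b x y z w = n)"

end

(* Representing 1, 2 and 6 forces a = 1 and b = 2.  For odd m the number 6m is a sum of three
   squares A^2 + B^2 + C^2, and after a choice of signs x = (A + B + 2C)/6, y = (A + B - C)/6,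
   z = (A - B)/6 are integers with m = x^2 + 2y^2 + 3z^2; an even n is reduced to n - 9 by
   z^2 + 3 = (z - 1)^2 + 2(z - 1) + 2^2.

   That 2m is a sum of three squares for odd m is shown by counting, in the spirit of Kronecker's
   class number relations and without Dirichlet's theorem.  Let r(m) be the number of
   a^2 + b^2 + c^2 = 2m with a, b odd and c even, and h(m) the number of xy + yz + zx = 2m with
   x >= 0, y, z > 0, only y odd.  For odd M the sum of r(M - 2w^2) over all integers w is 4 sigma(M)
   (Jacobi's count of four odd squares) and the sum of h(M - 2w^2) is sigma(M).  The term w = 0 can
   be solved for, so r = 4h by induction, and h(m) > 0 because of (0, m, 2). *)
theory Submission
  imports Defs
begin

section \<open>Counting positive solutions of $AB + EF = n$ by shears\<close>

text \<open>Three squares do not compose multiplicatively, so single values are hard to reach. The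
  shift by 4w^2 restores structure on both sides. By sums and differences of pairs, a^2 + b^2 + c^2
  + 4w^2 = 2M turns into four odd squares with sum 4M. And xy + yz + zx + 4w^2 can be written as AB
  + EF with all entries positive, by one identity for |2w| > y and another for |2w| < y. On the
  positive solutions of AB + EF = n, linear maps such as (A, B + E, E, F - A) are bijections between
  regions cut out by inequalities. The sizes of these regions obey a linear system, and what remains
  of it is a sum over the factorizations M = ae. Jacobi's count needs no generating functions
  either: f(N) = 16 sigma(N) and the number of representations of 4N by four odd squares both make
  the sum of (k - 5s^2) f((k - s^2)/4) over odd s vanish, for k = 4N + 1, and s = 1, -1 isolate
  f(N). Odd M matters throughout: then 2M = 2 modulo 4, which fixes the residue classes and excludes
  most ties between entries.\<close>

definition quads :: "int \<Rightarrow> (int \<Rightarrow> int \<Rightarrow> int \<Rightarrow> int \<Rightarrow> bool) \<Rightarrow> (int \<times> int \<times> int \<times> int) set" where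
  "quads n P = {(A, B, E, F). 0 < A \<and> 0 < B \<and> 0 < E \<and> 0 < F \<and> A * B + E * F = n \<and> P A B E F}"

definition cnt :: "int \<Rightarrow> (int \<Rightarrow> int \<Rightarrow> int \<Rightarrow> int \<Rightarrow> bool) \<Rightarrow> int" where
  "cnt n P = int (card (quads n P))"

lemma factor_le_mult: "0 < a \<Longrightarrow> 0 < b \<Longrightarrow> a \<le> a * (b::int)"
  using mult_left_mono[of 1 b a] by simp

lemma finite_quads: "finite (quads n P)"
proof (rule finite_subset)
  show "quads n P \<subseteq> {0..n} \<times> {0..n} \<times> {0..n} \<times> {0..n}"
  proof
    fix q assume "q \<in> quads n P"
    then obtain A B E F where q: "q = (A, B, E, F)" "0 < A" "0 < B" "0 < E" "0 < F" "A * B + E * F = n"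
      by (auto simp: quads_def)
    have "A \<le> A * B" "B \<le> A * B" "E \<le> E * F" "F \<le> E * F"
      using q factor_le_mult[of A B] factor_le_mult[of B A] factor_le_mult[of E F] factor_le_mult[of F E]
      by (simp_all only: mult.commute)
    with q have "A \<le> n" "B \<le> n" "E \<le> n" "F \<le> n" by linarith+
    with q show "q \<in> {0..n} \<times> {0..n} \<times> {0..n} \<times> {0..n}" by simp
  qed
qed auto

lemma cnt_cong:
  assumes "\<And>A B E F. 0 < A \<Longrightarrow> 0 < B \<Longrightarrow> 0 < E \<Longrightarrow> 0 < F \<Longrightarrow> P A B E F \<longleftrightarrow> Q A B E F"
  shows "cnt n P = cnt n Q"
proof -
  have "quads n P = quads n Q" using assms by (auto simp: quads_def)
  then show ?thesis by (simp add: cnt_def)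
qed

lemma cnt_disjoint:
  assumes "\<And>A B E F. 0 < A \<Longrightarrow> 0 < B \<Longrightarrow> 0 < E \<Longrightarrow> 0 < F \<Longrightarrow> P A B E F \<longleftrightarrow> Q A B E F \<or> R A B E F"
    and "\<And>A B E F. 0 < A \<Longrightarrow> 0 < B \<Longrightarrow> 0 < E \<Longrightarrow> 0 < F \<Longrightarrow> \<not> (Q A B E F \<and> R A B E F)"
  shows "cnt n P = cnt n Q + cnt n R"
proof -
  have "quads n P = quads n Q \<union> quads n R" "quads n Q \<inter> quads n R = {}"
    using assms by (auto simp: quads_def)
  then show ?thesis
    by (simp add: cnt_def card_Un_disjoint finite_quads)
qed

lemma cnt_swap_left: "cnt n (\<lambda>A B E F. P B A E F) = cnt n P"
proof -
  have "bij_betw (\<lambda>(A, B, E, F). (B, A, E, F)) (quads n (\<lambda>A B E F. P B A E F)) (quads n P)"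
    by (rule bij_betw_byWitness[where f' = "\<lambda>(A, B, E, F). (B, A, E, F)"])
       (auto simp: quads_def mult.commute)
  then show ?thesis by (simp add: cnt_def bij_betw_same_card)
qed

lemma cnt_swap_right: "cnt n (\<lambda>A B E F. P A B F E) = cnt n P"
proof -
  have "bij_betw (\<lambda>(A, B, E, F). (A, B, F, E)) (quads n (\<lambda>A B E F. P A B F E)) (quads n P)"
    by (rule bij_betw_byWitness[where f' = "\<lambda>(A, B, E, F). (A, B, F, E)"])
       (auto simp: quads_def mult.commute)
  then show ?thesis by (simp add: cnt_def bij_betw_same_card)
qed

lemma cnt_swap_pairs: "cnt n (\<lambda>A B E F. P E F A B) = cnt n P"
proof -
  have "bij_betw (\<lambda>(A, B, E, F). (E, F, A, B)) (quads n (\<lambda>A B E F. P E F A B)) (quads n P)"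
    by (rule bij_betw_byWitness[where f' = "\<lambda>(A, B, E, F). (E, F, A, B)"])
       (auto simp: quads_def)
  then show ?thesis by (simp add: cnt_def bij_betw_same_card)
qed

text \<open>A(B + E) + E(F - A) = AB + EF. The two order conditions say that F - A, respectively B -
  E for the inverse map, stays positive.\<close>

lemma cnt_shear: "cnt n (\<lambda>A B E F. A < F \<and> P A (B + E) E (F - A)) = cnt n (\<lambda>A B E F. E < B \<and> P A B E F)"
proof -
  have "bij_betw (\<lambda>(A, B, E, F). (A, B + E, E, F - A))
     (quads n (\<lambda>A B E F. A < F \<and> P A (B + E) E (F - A))) (quads n (\<lambda>A B E F. E < B \<and> P A B E F))"
    by (rule bij_betw_byWitness[where f' = "\<lambda>(A, B, E, F). (A, B - E, E, F + A)"])
       (auto simp: quads_def algebra_simps)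
  then show ?thesis by (simp add: cnt_def bij_betw_same_card)
qed

text \<open>
  Residue classes modulo 4 of the quadruples that occur. For $n \equiv 2$ modulo 4 some of the
  congruences follow from $AB + EF = n$; they are included so that every shear and symmetry
  between the classes is a statement about linear congruences only.
\<close>
definition class_O :: "int \<Rightarrow> int \<Rightarrow> int \<Rightarrow> int \<Rightarrow> bool" where
  "class_O A B E F \<longleftrightarrow> odd A \<and> odd B \<and> odd E \<and> odd F \<and> 4 dvd A + B \<and> 4 dvd E + F"
definition class_U :: "int \<Rightarrow> int \<Rightarrow> int \<Rightarrow> int \<Rightarrow> bool" where
  "class_U A B E F \<longleftrightarrow> odd A \<and> even B \<and> odd E \<and> even F \<and> 4 dvd F - A - E \<and> 4 dvd B + F + 2"
definition class_V2 :: "int \<Rightarrow> int \<Rightarrow> int \<Rightarrow> int \<Rightarrow> bool" where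
  "class_V2 A B E F \<longleftrightarrow> even A \<and> even B \<and> 4 dvd E + 2 \<and> odd F \<and> 4 dvd A + B + 2"
definition class_V0 :: "int \<Rightarrow> int \<Rightarrow> int \<Rightarrow> int \<Rightarrow> bool" where
  "class_V0 A B E F \<longleftrightarrow> even A \<and> even B \<and> 4 dvd E + 2 \<and> odd F \<and> 4 dvd A + B"
definition class_W2 :: "int \<Rightarrow> int \<Rightarrow> int \<Rightarrow> int \<Rightarrow> bool" where
  "class_W2 A B E F \<longleftrightarrow> even A \<and> odd B \<and> even E \<and> odd F \<and> 4 dvd A + E + 2 \<and> 4 dvd A + B - F + 2"
definition class_W0 :: "int \<Rightarrow> int \<Rightarrow> int \<Rightarrow> int \<Rightarrow> bool" where
  "class_W0 A B E F \<longleftrightarrow> even A \<and> odd B \<and> even E \<and> odd F \<and> 4 dvd A + E + 2 \<and> 4 dvd A + B - F"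

lemmas class_defs = class_O_def class_U_def class_V2_def class_V0_def class_W2_def class_W0_def

text \<open>The letters say which entry is subtracted from which: here A from F, with E added to B
  as compensation. The other three versions are conjugates of this one under A <-> B and E <-> F.
  The order condition is explicit on the source side and only has to follow from \<open>Q\<close> on
  the target side.\<close>

lemma shear_FA:
  assumes "\<And>A B E F. 0 < A \<Longrightarrow> 0 < B \<Longrightarrow> 0 < E \<Longrightarrow> 0 < F \<Longrightarrow> P A B E F \<longleftrightarrow> A < F \<and> Q A (B + E) E (F - A)"
    and "\<And>A B E F. 0 < A \<Longrightarrow> 0 < B \<Longrightarrow> 0 < E \<Longrightarrow> 0 < F \<Longrightarrow> Q A B E F \<Longrightarrow> E < B"
  shows "cnt n P = cnt n Q"
proof -
  have "cnt n P = cnt n (\<lambda>A B E F. A < F \<and> Q A (B + E) E (F - A))"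
    by (rule cnt_cong) (use assms(1) in blast)
  also have "\<dots> = cnt n (\<lambda>A B E F. E < B \<and> Q A B E F)" by (rule cnt_shear)
  also have "\<dots> = cnt n Q" by (rule cnt_cong) (use assms(2) in blast)
  finally show ?thesis .
qed

lemma shear_EA:
  assumes "\<And>A B E F. 0 < A \<Longrightarrow> 0 < B \<Longrightarrow> 0 < E \<Longrightarrow> 0 < F \<Longrightarrow> P A B E F \<longleftrightarrow> A < E \<and> Q A (B + F) (E - A) F"
    and "\<And>A B E F. 0 < A \<Longrightarrow> 0 < B \<Longrightarrow> 0 < E \<Longrightarrow> 0 < F \<Longrightarrow> Q A B E F \<Longrightarrow> F < B"
  shows "cnt n P = cnt n Q"
proof -
  have "cnt n (\<lambda>A B E F. P A B F E) = cnt n (\<lambda>A B E F. Q A B F E)"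
    by (rule shear_FA) (rule assms; assumption)+
  then show ?thesis by (simp only: cnt_swap_right[of n P] cnt_swap_right[of n Q])
qed

lemma shear_FB:
  assumes "\<And>A B E F. 0 < A \<Longrightarrow> 0 < B \<Longrightarrow> 0 < E \<Longrightarrow> 0 < F \<Longrightarrow> P A B E F \<longleftrightarrow> B < F \<and> Q (A + E) B E (F - B)"
    and "\<And>A B E F. 0 < A \<Longrightarrow> 0 < B \<Longrightarrow> 0 < E \<Longrightarrow> 0 < F \<Longrightarrow> Q A B E F \<Longrightarrow> E < A"
  shows "cnt n P = cnt n Q"
proof -
  have "cnt n (\<lambda>A B E F. P B A E F) = cnt n (\<lambda>A B E F. Q B A E F)"
    by (rule shear_FA) (rule assms; assumption)+
  then show ?thesis by (simp only: cnt_swap_left[of n P] cnt_swap_left[of n Q])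
qed

lemma shear_EB:
  assumes "\<And>A B E F. 0 < A \<Longrightarrow> 0 < B \<Longrightarrow> 0 < E \<Longrightarrow> 0 < F \<Longrightarrow> P A B E F \<longleftrightarrow> B < E \<and> Q (A + F) B (E - B) F"
    and "\<And>A B E F. 0 < A \<Longrightarrow> 0 < B \<Longrightarrow> 0 < E \<Longrightarrow> 0 < F \<Longrightarrow> Q A B E F \<Longrightarrow> F < A"
  shows "cnt n P = cnt n Q"
proof -
  have "cnt n (\<lambda>A B E F. P A B F E) = cnt n (\<lambda>A B E F. Q A B F E)"
    by (rule shear_FB) (rule assms; assumption)+
  then show ?thesis by (simp only: cnt_swap_right[of n P] cnt_swap_right[of n Q])
qed

section \<open>Symmetries and shears of the residue classes modulo 4\<close>

lemma class_O_sym: "class_O B A E F = class_O A B E F" "class_O A B F E = class_O A B E F" "class_O E F A B = class_O A B E F"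
  unfolding class_defs by (intro iffI; elim conjE; intro conjI; presburger)+
lemma V_sym: "class_V2 B A E F = class_V2 A B E F" "class_V0 B A E F = class_V0 A B E F"
  unfolding class_defs by (intro iffI; elim conjE; intro conjI; presburger)+
lemma W_swap: "class_W2 E F A B = class_W0 A B E F"
  unfolding class_defs by (intro iffI; elim conjE; intro conjI; presburger)+

text \<open>In these names, too, the second letter is the entry subtracted from the first; some of
  the maps also permute the entries, so that one shear can be read as landing in differently named
  classes.\<close>

lemma class_O_FA: "class_O A B E F = class_U A (B + E) E (F - A)"
  unfolding class_defs by (intro iffI; elim conjE; intro conjI; presburger)
lemma class_U_FB: "class_U A B E F = class_V2 (A + E) B (F - B) E"
  unfolding class_defs by (intro iffI; elim conjE; intro conjI; presburger)
lemma class_U_BF: "class_U A B E F = class_V0 (E + A) F (B - F) A"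
  unfolding class_defs by (intro iffI; elim conjE; intro conjI; presburger)
lemma class_V2_BE: "class_V2 A B E F = class_V0 A (B - E) E (F + A)"
  unfolding class_defs by (intro iffI; elim conjE; intro conjI; presburger)
lemma class_V2_EA: "class_V2 A B E F = class_W2 A (B + F) (E - A) F"
  unfolding class_defs by (intro iffI; elim conjE; intro conjI; presburger)
lemma class_W0_FA: "class_W0 A B E F = class_W2 A (B + E) E (F - A)"
  unfolding class_defs by (intro iffI; elim conjE; intro conjI; presburger)
lemma class_W2_EB: "class_W2 A B E F = class_O (A + F) B (E - B) F"
  unfolding class_defs by (intro iffI; elim conjE; intro conjI; presburger)
lemma class_W2_EA: "class_W2 A B E F = class_V0 A (B + F) (E - A) F"
  unfolding class_defs by (intro iffI; elim conjE; intro conjI; presburger)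
lemma class_W2_AE: "class_W2 A B E F = class_V2 E (F + B) (A - E) B"
  unfolding class_defs by (intro iffI; elim conjE; intro conjI; presburger)
lemma class_O_FA': "class_O A B E F = class_W0 (B + E) A (F - A) E"
  unfolding class_defs by (intro iffI; elim conjE; intro conjI; presburger)
lemma class_V2_AE: "class_V2 A B E F = class_V0 (A - E) B E (F + B)"
  unfolding class_defs by (intro iffI; elim conjE; intro conjI; presburger)
lemma class_V2_AF: "class_V2 A B E F = class_W0 B (A - F) (E + B) F"
  unfolding class_defs by (intro iffI; elim conjE; intro conjI; presburger)

lemma cnt_rotate: "cnt n (\<lambda>A B E F. P E F B A) = cnt n P"
  using cnt_swap_pairs[of n "\<lambda>A B E F. P A B F E"] cnt_swap_right[of n P] by simp

text \<open>Parity or a congruence modulo 4 excludes these ties, so splitting by strict inequalities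
  is exhaustive there. Ties that remain possible, such as A = F in \<open>class_O\<close> and A = E
  in \<open>class_V2\<close>, have to be carried along.\<close>

lemma class_O_neq: "class_O A B E F \<Longrightarrow> A \<noteq> B \<and> E \<noteq> F"
  unfolding class_defs by presburger
lemma class_U_neq: "class_U A B E F \<Longrightarrow> B \<noteq> F \<and> A + E \<noteq> B"
  unfolding class_defs by presburger
lemma class_V2_neq: "class_V2 A B E F \<Longrightarrow> A \<noteq> B \<and> A \<noteq> F \<and> B \<noteq> F"
  unfolding class_defs by presburger
lemma class_V0_neq: "class_V0 A B E F \<Longrightarrow> A \<noteq> F \<and> B \<noteq> F"
  unfolding class_defs by presburger
lemma class_W2_neq: "class_W2 A B E F \<Longrightarrow> A \<noteq> E \<and> A \<noteq> F \<and> B \<noteq> E \<and> A \<noteq> B"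
  unfolding class_defs by presburger
lemma class_W0_neq: "class_W0 A B E F \<Longrightarrow> A \<noteq> E \<and> A \<noteq> F \<and> B \<noteq> E"
  unfolding class_defs by presburger

lemmas class_neq = class_O_neq class_U_neq class_V2_neq class_V0_neq class_W2_neq class_W0_neq

section \<open>Linear relations between the sizes of regions\<close>

lemma class_O_shear: "cnt n (\<lambda>A B E F. class_O A B E F \<and> A < B \<and> 2 * A < F - E)
  = cnt n (\<lambda>A B E F. class_U A B E F \<and> A + E < F \<and> A + E < B)"
  by (rule shear_FA) (auto simp: class_O_FA)

lemma class_O_shear_le: "cnt n (\<lambda>A B E F. class_O A B E F \<and> A \<le> B \<and> 2 * A \<le> F - E)
  = cnt n (\<lambda>A B E F. class_U A B E F \<and> A + E \<le> F \<and> A + E \<le> B)"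
  by (rule shear_FA) (auto simp: class_O_FA dest: class_neq)

lemma class_U_shear1: "cnt n (\<lambda>A B E F. class_U A B E F \<and> A + E < B \<and> B < F) = cnt n (\<lambda>A B E F. class_V2 A B E F \<and> F < A \<and> A < B)"
proof -
  have "cnt n (\<lambda>A B E F. class_U A B E F \<and> A + E < B \<and> B < F) = cnt n (\<lambda>A B E F. class_V2 A B F E \<and> E < A \<and> A < B)"
    by (rule shear_FB) (auto simp: class_U_FB)
  also have "\<dots> = cnt n (\<lambda>A B E F. class_V2 A B E F \<and> F < A \<and> A < B)"
    by (rule cnt_swap_right)
  finally show ?thesis .
qed

lemma class_U_shear2: "cnt n (\<lambda>A B E F. class_U A B E F \<and> A + E < F \<and> F < B) = cnt n (\<lambda>A B E F. class_V0 A B E F \<and> F < A \<and> A < B)"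
proof -
  have "cnt n (\<lambda>A B E F. class_V0 A B E F \<and> F < A \<and> A < B) = cnt n (\<lambda>A B E F. class_V0 E F B A \<and> A < E \<and> E < F)"
    by (rule cnt_rotate[symmetric])
  also have "\<dots> = cnt n (\<lambda>A B E F. class_U A B E F \<and> A + E < F \<and> F < B)"
    by (rule shear_EA) (auto simp: class_U_BF)
  finally show ?thesis ..
qed

lemma class_U_shear2_le: "cnt n (\<lambda>A B E F. class_U A B E F \<and> A + E \<le> F \<and> F < B) = cnt n (\<lambda>A B E F. class_V0 A B E F \<and> F < A \<and> A \<le> B)"
proof -
  have "cnt n (\<lambda>A B E F. class_V0 A B E F \<and> F < A \<and> A \<le> B) = cnt n (\<lambda>A B E F. class_V0 E F B A \<and> A < E \<and> E \<le> F)"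
    by (rule cnt_rotate[symmetric])
  also have "\<dots> = cnt n (\<lambda>A B E F. class_U A B E F \<and> A + E \<le> F \<and> F < B)"
    by (rule shear_EA) (auto simp: class_U_BF)
  finally show ?thesis ..
qed

text \<open>Take E < F by symmetry. Outside the first region, F - E is large against the smaller of
  A and B; subtracting that entry from F leads to \<open>class_U\<close>, where comparing B with F
  decides between \<open>class_V2\<close> and \<open>class_V0\<close>. The bound is weak for A and
  strict for B because A - (F - E)/2 will be the x >= 0 and B - (F - E)/2 the z > 0 of
  \<open>triples\<close>.\<close>

lemma cnt_class_O:
  "cnt n class_O = 2 * cnt n (\<lambda>A B E F. class_O A B E F \<and> E < F \<and> F - E \<le> 2 * A \<and> F - E < 2 * B)
     + 2 * cnt n (\<lambda>A B E F. class_V2 A B E F \<and> F < A \<and> F < B) + 2 * cnt n (\<lambda>A B E F. class_V0 A B E F \<and> F < A \<and> F < B)"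
proof -
  have "cnt n class_O = cnt n (\<lambda>A B E F. class_O A B E F \<and> E < F) + cnt n (\<lambda>A B E F. class_O A B F E \<and> F < E)"
    by (rule cnt_disjoint) (auto simp: class_O_sym dest: class_neq)
  also have "cnt n (\<lambda>A B E F. class_O A B F E \<and> F < E) = cnt n (\<lambda>A B E F. class_O A B E F \<and> E < F)"
    by (rule cnt_swap_right)
  finally have 1: "cnt n class_O = 2 * cnt n (\<lambda>A B E F. class_O A B E F \<and> E < F)" by simp
  have "cnt n (\<lambda>A B E F. class_O A B E F \<and> E < F)
    = cnt n (\<lambda>A B E F. class_O A B E F \<and> E < F \<and> F - E \<le> 2 * A \<and> F - E < 2 * B)
    + cnt n (\<lambda>A B E F. class_O A B E F \<and> (A < B \<and> 2 * A < F - E \<or> B \<le> A \<and> 2 * B \<le> F - E))"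
    by (rule cnt_disjoint) auto
  also have "cnt n (\<lambda>A B E F. class_O A B E F \<and> (A < B \<and> 2 * A < F - E \<or> B \<le> A \<and> 2 * B \<le> F - E))
    = cnt n (\<lambda>A B E F. class_O A B E F \<and> A < B \<and> 2 * A < F - E)
    + cnt n (\<lambda>A B E F. class_O B A E F \<and> B \<le> A \<and> 2 * B \<le> F - E)"
    by (rule cnt_disjoint) (auto simp: class_O_sym)
  also have "cnt n (\<lambda>A B E F. class_O B A E F \<and> B \<le> A \<and> 2 * B \<le> F - E)
    = cnt n (\<lambda>A B E F. class_O A B E F \<and> A \<le> B \<and> 2 * A \<le> F - E)"
    by (rule cnt_swap_left)
  finally have 2: "cnt n (\<lambda>A B E F. class_O A B E F \<and> E < F)
    = cnt n (\<lambda>A B E F. class_O A B E F \<and> E < F \<and> F - E \<le> 2 * A \<and> F - E < 2 * B)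
    + (cnt n (\<lambda>A B E F. class_U A B E F \<and> A + E < F \<and> A + E < B)
      + cnt n (\<lambda>A B E F. class_U A B E F \<and> A + E \<le> F \<and> A + E \<le> B))"
    by (simp only: class_O_shear class_O_shear_le)
  have 3: "cnt n (\<lambda>A B E F. class_U A B E F \<and> A + E < F \<and> A + E < B)
    = cnt n (\<lambda>A B E F. class_V2 A B E F \<and> F < A \<and> A < B) + cnt n (\<lambda>A B E F. class_V0 A B E F \<and> F < A \<and> A < B)"
    unfolding class_U_shear1[symmetric] class_U_shear2[symmetric]
    by (rule cnt_disjoint) (auto dest: class_neq)
  have 4: "cnt n (\<lambda>A B E F. class_U A B E F \<and> A + E \<le> F \<and> A + E \<le> B)
    = cnt n (\<lambda>A B E F. class_V2 A B E F \<and> F < A \<and> A < B) + cnt n (\<lambda>A B E F. class_V0 A B E F \<and> F < A \<and> A \<le> B)"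
    unfolding class_U_shear1[symmetric] class_U_shear2_le[symmetric]
    by (rule cnt_disjoint) (auto dest: class_neq)
  have 5: "cnt n (\<lambda>A B E F. class_V2 A B E F \<and> F < A \<and> F < B) = 2 * cnt n (\<lambda>A B E F. class_V2 A B E F \<and> F < A \<and> A < B)"
  proof -
    have "cnt n (\<lambda>A B E F. class_V2 A B E F \<and> F < A \<and> F < B) = cnt n (\<lambda>A B E F. class_V2 A B E F \<and> F < A \<and> A < B)
      + cnt n (\<lambda>A B E F. class_V2 B A E F \<and> F < B \<and> B < A)"
      by (rule cnt_disjoint) (auto simp: V_sym dest: class_neq)
    also have "cnt n (\<lambda>A B E F. class_V2 B A E F \<and> F < B \<and> B < A) = cnt n (\<lambda>A B E F. class_V2 A B E F \<and> F < A \<and> A < B)"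
      by (rule cnt_swap_left)
    finally show ?thesis by simp
  qed
  have 6: "cnt n (\<lambda>A B E F. class_V0 A B E F \<and> F < A \<and> F < B)
    = cnt n (\<lambda>A B E F. class_V0 A B E F \<and> F < A \<and> A < B) + cnt n (\<lambda>A B E F. class_V0 A B E F \<and> F < A \<and> A \<le> B)"
  proof -
    have "cnt n (\<lambda>A B E F. class_V0 A B E F \<and> F < A \<and> F < B) = cnt n (\<lambda>A B E F. class_V0 A B E F \<and> F < A \<and> A < B)
      + cnt n (\<lambda>A B E F. class_V0 B A E F \<and> F < B \<and> B \<le> A)"
      by (rule cnt_disjoint) (auto simp: V_sym)
    also have "cnt n (\<lambda>A B E F. class_V0 B A E F \<and> F < B \<and> B \<le> A) = cnt n (\<lambda>A B E F. class_V0 A B E F \<and> F < A \<and> A \<le> B)"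
      by (rule cnt_swap_left)
    finally show ?thesis .
  qed
  show ?thesis using 1 2 3 4 5 6 by linarith
qed

lemma cnt_reverse: "cnt n (\<lambda>A B E F. P F E B A) = cnt n P"
  using cnt_rotate[of n "\<lambda>A B E F. P B A E F"] cnt_swap_left[of n P] by simp

lemma cnt_swap_both: "cnt n (\<lambda>A B E F. P B A F E) = cnt n P"
  using cnt_swap_left[of n "\<lambda>A B E F. P A B F E"] cnt_swap_right[of n P] by simp

lemma class_V2_shear_BE: "cnt n (\<lambda>A B E F. class_V2 A B E F \<and> A + E < B) = cnt n (\<lambda>A B E F. class_V0 A B E F \<and> A < B \<and> A < F)"
  by (rule shear_FA[symmetric]) (auto simp: class_V2_BE)

lemma class_V2_shear_BE_le: "cnt n (\<lambda>A B E F. class_V2 A B E F \<and> A + E \<le> B) = cnt n (\<lambda>A B E F. class_V0 A B E F \<and> A \<le> B \<and> A < F)"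
  by (rule shear_FA[symmetric]) (auto simp: class_V2_BE)

text \<open>Cut by the triangle inequalities for A, B, E. Where A + E < B or B + E <= A, a shear
  leads to the part of \<open>class_V0\<close> in which F exceeds A or B, whose complement is F < A,
  F < B. The region E >= A + B is kept as it stands.\<close>

lemma cnt_class_V2:
  "cnt n class_V2 = cnt n (\<lambda>A B E F. class_V2 A B E F \<and> B - A \<le> E \<and> A - B < E \<and> E < A + B)
     + cnt n class_V0 - cnt n (\<lambda>A B E F. class_V0 A B E F \<and> F < A \<and> F < B)
     + cnt n (\<lambda>A B E F. class_V2 A B E F \<and> E = A + B) + cnt n (\<lambda>A B E F. class_V2 A B E F \<and> A + B < E)"
proof -
  have "cnt n class_V2 = cnt n (\<lambda>A B E F. class_V2 A B E F \<and> A + B \<le> E) + cnt n (\<lambda>A B E F. class_V2 A B E F \<and> E < A + B)"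
    by (rule cnt_disjoint) auto
  moreover have "cnt n (\<lambda>A B E F. class_V2 A B E F \<and> A + B \<le> E)
    = cnt n (\<lambda>A B E F. class_V2 A B E F \<and> E = A + B) + cnt n (\<lambda>A B E F. class_V2 A B E F \<and> A + B < E)"
    by (rule cnt_disjoint) auto
  moreover have "cnt n (\<lambda>A B E F. class_V2 A B E F \<and> E < A + B)
    = cnt n (\<lambda>A B E F. class_V2 A B E F \<and> B - A \<le> E \<and> A - B < E \<and> E < A + B)
    + cnt n (\<lambda>A B E F. class_V2 A B E F \<and> (A + E < B \<or> B + E \<le> A))"
    by (rule cnt_disjoint) auto
  moreover have "cnt n (\<lambda>A B E F. class_V2 A B E F \<and> (A + E < B \<or> B + E \<le> A))
    = cnt n (\<lambda>A B E F. class_V2 A B E F \<and> A + E < B) + cnt n (\<lambda>A B E F. class_V2 B A E F \<and> B + E \<le> A)"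
    by (rule cnt_disjoint) (auto simp: V_sym)
  moreover have "cnt n (\<lambda>A B E F. class_V2 B A E F \<and> B + E \<le> A) = cnt n (\<lambda>A B E F. class_V2 A B E F \<and> A + E \<le> B)"
    by (rule cnt_swap_left)
  moreover have "cnt n (\<lambda>A B E F. class_V0 A B E F \<and> A \<le> B \<and> A < F) = cnt n (\<lambda>A B E F. class_V0 B A E F \<and> B \<le> A \<and> B < F)"
    by (rule cnt_swap_left[symmetric])
  moreover have "cnt n (\<lambda>A B E F. class_V0 A B E F \<and> (A < F \<or> B < F))
    = cnt n (\<lambda>A B E F. class_V0 A B E F \<and> A < B \<and> A < F) + cnt n (\<lambda>A B E F. class_V0 B A E F \<and> B \<le> A \<and> B < F)"
    by (rule cnt_disjoint) (auto simp: V_sym)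
  moreover have "cnt n class_V0 = cnt n (\<lambda>A B E F. class_V0 A B E F \<and> (A < F \<or> B < F)) + cnt n (\<lambda>A B E F. class_V0 A B E F \<and> F < A \<and> F < B)"
    by (rule cnt_disjoint) (auto dest: class_neq)
  ultimately show ?thesis
    using class_V2_shear_BE[of n] class_V2_shear_BE_le[of n] by linarith
qed

lemma class_V2_shear_EA: "cnt n (\<lambda>A B E F. class_V2 A B E F \<and> A < E \<and> E < A + B) = cnt n (\<lambda>A B E F. class_W2 A B E F \<and> E + F < B)"
  by (rule shear_EA) (auto simp: class_V2_EA)

lemma class_V2_shear_EA_eq: "cnt n (\<lambda>A B E F. class_V2 A B E F \<and> E = A + B) = cnt n (\<lambda>A B E F. class_W2 A B E F \<and> B = E + F)"
  by (rule shear_EA) (auto simp: class_V2_EA)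

lemma class_W0_shear_FA: "cnt n (\<lambda>A B E F. class_W0 A B E F \<and> A + B < F) = cnt n (\<lambda>A B E F. class_W2 A B E F \<and> E < B \<and> B < E + F)"
  by (rule shear_FA) (auto simp: class_W0_FA)

text \<open>A shear takes A < E < A + B in \<open>class_V2\<close> to E + F < B in
  \<open>class_W2\<close>. Exchanging the two products and shearing once more takes this to E < B <
  E + F in \<open>class_W2\<close>. So the region E < B consists of two equinumerous parts and the
  tie B = E + F.\<close>

lemma cnt_class_V2_class_W2:
  "2 * cnt n (\<lambda>A B E F. class_V2 A B E F \<and> A + B < E) + cnt n (\<lambda>A B E F. class_V2 A B E F \<and> E = A + B)
    + cnt n (\<lambda>A B E F. class_W2 A B E F \<and> E < B) = 2 * cnt n (\<lambda>A B E F. class_V2 A B E F \<and> A < E)"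
proof -
  have "cnt n (\<lambda>A B E F. class_V2 A B E F \<and> A < E)
    = cnt n (\<lambda>A B E F. class_V2 A B E F \<and> A < E \<and> E < A + B) + cnt n (\<lambda>A B E F. class_V2 A B E F \<and> A + B \<le> E)"
    by (rule cnt_disjoint) auto
  moreover have "cnt n (\<lambda>A B E F. class_V2 A B E F \<and> A + B \<le> E)
    = cnt n (\<lambda>A B E F. class_V2 A B E F \<and> E = A + B) + cnt n (\<lambda>A B E F. class_V2 A B E F \<and> A + B < E)"
    by (rule cnt_disjoint) auto
  moreover have "cnt n (\<lambda>A B E F. class_W2 A B E F \<and> E < B)
    = cnt n (\<lambda>A B E F. class_W2 A B E F \<and> E < B \<and> B < E + F) + cnt n (\<lambda>A B E F. class_W2 A B E F \<and> E + F \<le> B)"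
    by (rule cnt_disjoint) auto
  moreover have "cnt n (\<lambda>A B E F. class_W2 A B E F \<and> E + F \<le> B)
    = cnt n (\<lambda>A B E F. class_W2 A B E F \<and> B = E + F) + cnt n (\<lambda>A B E F. class_W2 A B E F \<and> E + F < B)"
    by (rule cnt_disjoint) auto
  moreover have "cnt n (\<lambda>A B E F. class_W2 A B E F \<and> E + F < B) = cnt n (\<lambda>A B E F. class_W0 A B E F \<and> A + B < F)"
    using cnt_swap_pairs[of n "\<lambda>A B E F. class_W2 A B E F \<and> E + F < B"] by (simp add: W_swap)
  ultimately show ?thesis
    using class_V2_shear_EA[of n] class_V2_shear_EA_eq[of n] class_W0_shear_FA[of n] by linarith
qed

lemma class_O_FA_cnt: "cnt n (\<lambda>A B E F. class_O A B E F \<and> A < F) = cnt n (\<lambda>A B E F. class_W0 A B E F \<and> F < A)"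
proof -
  have "cnt n (\<lambda>A B E F. class_O A B E F \<and> A < F) = cnt n (\<lambda>A B E F. class_W0 B A F E \<and> E < B)"
    by (rule shear_FA) (auto simp: class_O_FA')
  also have "\<dots> = cnt n (\<lambda>A B E F. class_W0 A B E F \<and> F < A)"
    by (rule cnt_swap_both)
  finally show ?thesis .
qed

lemma class_W2_EB_cnt: "cnt n (\<lambda>A B E F. class_W2 A B E F \<and> B < E) = cnt n (\<lambda>A B E F. class_O A B E F \<and> A < F)"
proof -
  have "cnt n (\<lambda>A B E F. class_W2 A B E F \<and> B < E) = cnt n (\<lambda>A B E F. class_O A B E F \<and> F < A)"
    by (rule shear_EB) (auto simp: class_W2_EB)
  also have "\<dots> = cnt n (\<lambda>A B E F. class_O A B E F \<and> A < F)"
    using cnt_reverse[of n "\<lambda>A B E F. class_O A B E F \<and> A < F"] by (simp add: class_O_sym)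
  finally show ?thesis .
qed

lemma class_W2_EA_cnt: "cnt n (\<lambda>A B E F. class_W2 A B E F \<and> A < E) = cnt n (\<lambda>A B E F. class_V0 A B E F \<and> F < B)"
  by (rule shear_EA) (auto simp: class_W2_EA)

lemma class_W2_AE_cnt: "cnt n (\<lambda>A B E F. class_W2 A B E F \<and> E < A) = cnt n (\<lambda>A B E F. class_V2 A B E F \<and> F < B)"
proof -
  have "cnt n (\<lambda>A B E F. class_V2 A B E F \<and> F < B) = cnt n (\<lambda>A B E F. class_V2 E F A B \<and> B < F)"
    by (rule cnt_swap_pairs[symmetric])
  also have "\<dots> = cnt n (\<lambda>A B E F. class_W2 A B E F \<and> E < A)"
    by (rule shear_FB) (auto simp: class_W2_AE)
  finally show ?thesis ..
qed

lemma class_V2_AE_cnt: "cnt n (\<lambda>A B E F. class_V2 A B E F \<and> E < A) = cnt n (\<lambda>A B E F. class_V0 A B E F \<and> B < F)"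
  by (rule shear_FB[symmetric]) (auto simp: class_V2_AE)

lemma class_V2_AF_cnt: "cnt n (\<lambda>A B E F. class_V2 A B E F \<and> F < A \<and> F < B) = cnt n (\<lambda>A B E F. class_W0 A B E F \<and> F < A \<and> A < E)"
proof -
  have "cnt n (\<lambda>A B E F. class_W0 A B E F \<and> F < A \<and> A < E) = cnt n (\<lambda>A B E F. class_W0 B A E F \<and> F < B \<and> B < E)"
    by (rule cnt_swap_left[symmetric])
  also have "\<dots> = cnt n (\<lambda>A B E F. class_V2 A B E F \<and> F < A \<and> F < B)"
    by (rule shear_EB) (auto simp: class_V2_AF)
  finally show ?thesis ..
qed

text \<open>A shear into \<open>class_W2\<close> followed by the exchange of the products returns to
  \<open>class_W0\<close>, which makes two regions of one class equinumerous.\<close>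

lemma class_W0_between: "cnt n (\<lambda>A B E F. class_W0 A B E F \<and> E < A \<and> A < F) = cnt n (\<lambda>A B E F. class_W0 A B E F \<and> A < E \<and> A < F)"
proof -
  have "cnt n (\<lambda>A B E F. class_W0 A B E F \<and> E < A \<and> A < F) = cnt n (\<lambda>A B E F. class_W2 A B E F \<and> E < A \<and> E < B)"
    by (rule shear_FA) (auto simp: class_W0_FA)
  also have "\<dots> = cnt n (\<lambda>A B E F. class_W0 A B E F \<and> A < E \<and> A < F)"
    using cnt_swap_pairs[of n "\<lambda>A B E F. class_W2 A B E F \<and> E < A \<and> E < B"] by (simp add: W_swap)
  finally show ?thesis .
qed

lemma class_W2_class_W0_cnt:
  "cnt n (\<lambda>A B E F. class_W2 A B E F \<and> A < E) = cnt n (\<lambda>A B E F. class_W0 A B E F \<and> E < A)"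
  "cnt n (\<lambda>A B E F. class_W2 A B E F \<and> E < A) = cnt n (\<lambda>A B E F. class_W0 A B E F \<and> A < E)"
  using cnt_swap_pairs[of n "\<lambda>A B E F. class_W2 A B E F \<and> A < E"]
    cnt_swap_pairs[of n "\<lambda>A B E F. class_W2 A B E F \<and> E < A"] by (simp_all add: W_swap)

text \<open>All shears used here need only a comparison of single entries, and such comparisons
  partition each class. On A = F and A = E the subtraction would produce the entry 0, so these
  diagonals are left over.\<close>

lemma cnt_classes:
  "cnt n class_O + 2 * cnt n class_V2 + cnt n (\<lambda>A B E F. class_W2 A B E F \<and> E < B)
   = cnt n (\<lambda>A B E F. class_O A B E F \<and> A = F) + 2 * cnt n (\<lambda>A B E F. class_V2 A B E F \<and> A = E)
     + 2 * cnt n class_V0 + 2 * cnt n (\<lambda>A B E F. class_V2 A B E F \<and> F < A \<and> F < B) + 2 * cnt n (\<lambda>A B E F. class_V2 A B E F \<and> A < E)"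
proof -
  have "cnt n class_O = cnt n (\<lambda>A B E F. class_O A B E F \<and> A \<noteq> F) + cnt n (\<lambda>A B E F. class_O A B E F \<and> A = F)"
    by (rule cnt_disjoint) auto
  moreover have "cnt n (\<lambda>A B E F. class_O A B E F \<and> A \<noteq> F) = cnt n (\<lambda>A B E F. class_O A B E F \<and> A < F) + cnt n (\<lambda>A B E F. class_O A B E F \<and> F < A)"
    by (rule cnt_disjoint) auto
  moreover have "cnt n (\<lambda>A B E F. class_O A B E F \<and> F < A) = cnt n (\<lambda>A B E F. class_O A B E F \<and> A < F)"
    using cnt_reverse[of n "\<lambda>A B E F. class_O A B E F \<and> A < F"] by (simp add: class_O_sym)
  moreover have "cnt n class_W2 = cnt n (\<lambda>A B E F. class_W2 A B E F \<and> E < B) + cnt n (\<lambda>A B E F. class_W2 A B E F \<and> B < E)"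
    by (rule cnt_disjoint) (auto dest: class_neq)
  moreover have "cnt n class_W2 = cnt n (\<lambda>A B E F. class_W2 A B E F \<and> A < E) + cnt n (\<lambda>A B E F. class_W2 A B E F \<and> E < A)"
    by (rule cnt_disjoint) (auto dest: class_neq)
  moreover have "cnt n class_V2 = cnt n (\<lambda>A B E F. class_V2 A B E F \<and> A \<noteq> E) + cnt n (\<lambda>A B E F. class_V2 A B E F \<and> A = E)"
    by (rule cnt_disjoint) auto
  moreover have "cnt n (\<lambda>A B E F. class_V2 A B E F \<and> A \<noteq> E) = cnt n (\<lambda>A B E F. class_V2 A B E F \<and> A < E) + cnt n (\<lambda>A B E F. class_V2 A B E F \<and> E < A)"
    by (rule cnt_disjoint) auto
  moreover have "cnt n class_V0 = cnt n (\<lambda>A B E F. class_V0 A B E F \<and> F < B) + cnt n (\<lambda>A B E F. class_V0 A B E F \<and> B < F)"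
    by (rule cnt_disjoint) (auto dest: class_neq)
  moreover have "cnt n (\<lambda>A B E F. class_W0 A B E F \<and> F < A)
     = cnt n (\<lambda>A B E F. class_W0 A B E F \<and> F < A \<and> E < A) + cnt n (\<lambda>A B E F. class_W0 A B E F \<and> F < A \<and> A < E)"
    by (rule cnt_disjoint) (auto dest: class_neq)
  moreover have "cnt n (\<lambda>A B E F. class_W0 A B E F \<and> E < A)
     = cnt n (\<lambda>A B E F. class_W0 A B E F \<and> F < A \<and> E < A) + cnt n (\<lambda>A B E F. class_W0 A B E F \<and> E < A \<and> A < F)"
    by (rule cnt_disjoint) (auto dest: class_neq)
  moreover have "cnt n (\<lambda>A B E F. class_W0 A B E F \<and> A < E)
     = cnt n (\<lambda>A B E F. class_W0 A B E F \<and> A < E \<and> A < F) + cnt n (\<lambda>A B E F. class_W0 A B E F \<and> F < A \<and> A < E)"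
    by (rule cnt_disjoint) (auto dest: class_neq)
  ultimately show ?thesis
    using class_O_FA_cnt[of n] class_W2_EB_cnt[of n] class_W2_EA_cnt[of n] class_W2_AE_cnt[of n] class_V2_AE_cnt[of n] class_V2_AF_cnt[of n]
      class_W0_between[of n] class_W2_class_W0_cnt[of n] by linarith
qed

text \<open>
  The shears and symmetries trade every inequality that does not compare single entries for one
  that does; these cancel, and only the diagonals $A = F$ and $A = E$ survive.
\<close>
lemma cnt_balance:
  "2 * cnt n (\<lambda>A B E F. class_O A B E F \<and> E < F \<and> F - E \<le> 2 * A \<and> F - E < 2 * B)
   + 2 * cnt n (\<lambda>A B E F. class_V2 A B E F \<and> B - A \<le> E \<and> A - B < E \<and> E < A + B)
   + cnt n (\<lambda>A B E F. class_V2 A B E F \<and> E = A + B)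
   = cnt n (\<lambda>A B E F. class_O A B E F \<and> A = F) + 2 * cnt n (\<lambda>A B E F. class_V2 A B E F \<and> A = E)"
  using cnt_class_O[of n] cnt_class_V2[of n] cnt_class_V2_class_W2[of n] cnt_classes[of n] by linarith

section \<open>A class number relation\<close>

definition divisor_pairs :: "int \<Rightarrow> (int \<times> int) set" where
  "divisor_pairs N = {(y, z). 0 < y \<and> 0 < z \<and> y * z = N}"

definition sigma :: "int \<Rightarrow> int" where
  "sigma N = (\<Sum>(y, z)\<in>divisor_pairs N. y)"

lemma finite_divisor_pairs: "finite (divisor_pairs N)"
proof (rule finite_subset)
  show "divisor_pairs N \<subseteq> {0..N} \<times> {0..N}"
    using factor_le_mult by (auto simp: divisor_pairs_def)
qed auto

lemma sum_divisor_pairs_swap: "(\<Sum>(y, z)\<in>divisor_pairs N. f z y) = (\<Sum>(y, z)\<in>divisor_pairs N. f y z)"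
  by (rule sum.reindex_bij_witness[of _ "\<lambda>(y, z). (z, y)" "\<lambda>(y, z). (z, y)"])
     (auto simp: divisor_pairs_def mult.commute)

definition triples :: "int \<Rightarrow> (int \<times> int \<times> int) set" where
  "triples m = {(x, y, z). 0 \<le> x \<and> 0 < y \<and> 0 < z \<and> even x \<and> odd y \<and> even z \<and> x * y + y * z + z * x = 2 * m}"

definition shifted :: "int \<Rightarrow> (int \<times> int \<times> int \<times> int) set" where
  "shifted M = {(w, t). t \<in> triples (M - 2 * w\<^sup>2)}"

section \<open>Evaluating the two diagonals as a divisor sum\<close>

lemma card_progression:
  fixes r q L :: int
  assumes "0 < r" "r \<le> 4" "0 \<le> q" "4 * q + r - 4 < L" "L \<le> 4 * q + r"
  shows "int (card {B. 0 < B \<and> B < L \<and> 4 dvd B - r}) = q"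
proof -
  \<comment> \<open>The residue r runs through 1..4 instead of 0..3, so that r itself is the least
    positive member; the bounds on L say that 4(q - 1) + r is the last member below L.\<close>
  have "{B. 0 < B \<and> B < L \<and> 4 dvd B - r} = (\<lambda>j. 4 * j + r) ` {0..<q}"
  proof (intro set_eqI iffI)
    fix B assume "B \<in> {B. 0 < B \<and> B < L \<and> 4 dvd B - r}"
    then obtain j where "B - r = 4 * j" "0 < B" "B < L" by (auto simp: dvd_def)
    then have "B = 4 * j + r" "j \<in> {0..<q}" using assms by auto
    then show "B \<in> (\<lambda>j. 4 * j + r) ` {0..<q}" by blast
  qed (use assms in auto)
  moreover have "inj_on (\<lambda>j. 4 * j + r) {0..<q}" by (auto simp: inj_on_def)
  ultimately show ?thesis using assms(3) by (simp add: card_image)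
qed

text \<open>The contribution of one factorization M = ae: two diagonal terms, and 1 for the solution
  with w = x = 0. The correction terms are antisymmetric in a and e, so they cancel in the sum over
  all factorizations and only e remains.\<close>

lemma card_diagonal:
  fixes a e :: int
  assumes "odd a" "odd e" "0 < e"
  shows "int (card {B. 0 < B \<and> B < 2 * e \<and> odd B \<and> 4 dvd a + B}) + 2 * int (card {B. 0 < B \<and> B < e \<and> 4 dvd B}) + 1
    = e + of_bool (a mod 4 = 3) - of_bool (e mod 4 = 3)"
proof -
  define q where "q = e div 4"
  have e: "e mod 4 = 1 \<and> e = 4 * q + 1 \<or> e mod 4 = 3 \<and> e = 4 * q + 3" and q: "0 \<le> q"
    using assms unfolding q_def by presburger+
  have a: "a mod 4 = 1 \<or> a mod 4 = 3" using assms by presburger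
  have S2: "int (card {B. 0 < B \<and> B < e \<and> 4 dvd B}) = q"
  proof -
    have "4 dvd B \<longleftrightarrow> 4 dvd B - 4" for B :: int by presburger
    then have "{B. 0 < B \<and> B < e \<and> 4 dvd B} = {B. 0 < B \<and> B < e \<and> 4 dvd B - 4}" by blast
    moreover have "int (card {B. 0 < B \<and> B < e \<and> 4 dvd B - 4}) = q"
      by (rule card_progression) (use e q in auto)
    ultimately show ?thesis by (simp only:)
  qed
  have S1: "{B. 0 < B \<and> B < 2 * e \<and> odd B \<and> 4 dvd a + B} = {B. 0 < B \<and> B < 2 * e \<and> 4 dvd B - (if a mod 4 = 1 then 3 else 1)}"
    (is "?L = ?R")
  proof -
    have "odd B \<and> 4 dvd a + B \<longleftrightarrow> 4 dvd B - (if a mod 4 = 1 then 3 else 1)" for B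
      using a by (auto; presburger)
    then show ?thesis by auto
  qed
  show ?thesis
    unfolding S1 S2
    using a e q card_progression[of 3 "2 * q" "2 * e"] card_progression[of 1 "2 * q + 1" "2 * e"]
      card_progression[of 3 "2 * q + 1" "2 * e"] card_progression[of 1 "2 * q + 2" "2 * e"]
    by auto
qed

text \<open>For A = F the equation reads A(B + E) = 2M with B + E even, so a = A and e = (B + E)/2
  give M = ae, and B varies in a residue class modulo 4 below 2e.\<close>

lemma cnt_class_O_diagonal:
  assumes "odd M"
  shows "cnt (2 * M) (\<lambda>A B E F. class_O A B E F \<and> A = F)
    = (\<Sum>(a, e)\<in>divisor_pairs M. int (card {B. 0 < B \<and> B < 2 * e \<and> odd B \<and> 4 dvd a + B}))"
proof -
  let ?S = "\<lambda>(a, e). {B. 0 < B \<and> B < 2 * e \<and> odd B \<and> 4 dvd a + (B::int)}"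
  have fin: "finite (?S p)" for p
    by (rule finite_subset[of _ "{0..2 * snd p}"]) (auto split: prod.splits)
  have "bij_betw (\<lambda>((a, e), B). (a, B, 2 * e - B, a)) (Sigma (divisor_pairs M) ?S)
     (quads (2 * M) (\<lambda>A B E F. class_O A B E F \<and> A = F))"
  proof (rule bij_betw_byWitness[where f' = "\<lambda>(A, B, E, F). ((A, (B + E) div 2), B)"])
    show "\<forall>p\<in>Sigma (divisor_pairs M) ?S. (\<lambda>(A, B, E, F). ((A, (B + E) div 2), B)) ((\<lambda>((a, e), B). (a, B, 2 * e - B, a)) p) = p"
      by auto
    show "\<forall>q\<in>quads (2 * M) (\<lambda>A B E F. class_O A B E F \<and> A = F). (\<lambda>((a, e), B). (a, B, 2 * e - B, a)) ((\<lambda>(A, B, E, F). ((A, (B + E) div 2), B)) q) = q"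
      by (auto simp: quads_def class_O_def)
    show "(\<lambda>((a, e), B). (a, B, 2 * e - B, a)) ` Sigma (divisor_pairs M) ?S \<subseteq> quads (2 * M) (\<lambda>A B E F. class_O A B E F \<and> A = F)"
    proof clarify
      fix a e B assume p: "(a, e) \<in> divisor_pairs M" and B: "0 < B" "B < 2 * e" "odd B" "4 dvd a + B"
      have ae: "0 < a" "0 < e" "a * e = M" using p by (auto simp: divisor_pairs_def)
      then have "odd a" "odd e" using assms by auto
      then have "4 dvd 2 * e - B + a" using B(4) by presburger
      moreover have "a * B + (2 * e - B) * a = 2 * M" using ae by (auto simp: algebra_simps)
      ultimately show "(a, B, 2 * e - B, a) \<in> quads (2 * M) (\<lambda>A B E F. class_O A B E F \<and> A = F)"
        using B ae \<open>odd a\<close> by (auto simp: quads_def class_O_def)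
    qed
    show "(\<lambda>(A, B, E, F). ((A, (B + E) div 2), B)) ` quads (2 * M) (\<lambda>A B E F. class_O A B E F \<and> A = F) \<subseteq> Sigma (divisor_pairs M) ?S"
    proof (rule image_subsetI)
      fix p assume p: "p \<in> quads (2 * M) (\<lambda>A B E F. class_O A B E F \<and> A = F)"
      obtain A B E F where pq: "p = (A, B, E, F)" by (cases p)
      from p have q': "0 < A" "0 < B" "0 < E" "A * B + E * A = 2 * M" "odd B" "odd E" "4 dvd A + B"
        by (auto simp: pq quads_def class_O_def)
      obtain e where e: "B + E = 2 * e" using q'(5,6) by (metis evenE odd_even_add)
      have "A * (2 * e) = 2 * M" using q'(4) e by (metis mult.commute distrib_left)
      then have "A * e = M" by simp
      then show "(\<lambda>(A, B, E, F). ((A, (B + E) div 2), B)) p \<in> Sigma (divisor_pairs M) ?S"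
        using q' e by (auto simp: pq divisor_pairs_def)
    qed
  qed
  then have "cnt (2 * M) (\<lambda>A B E F. class_O A B E F \<and> A = F) = int (card (Sigma (divisor_pairs M) ?S))"
    by (simp add: cnt_def bij_betw_same_card)
  also have "\<dots> = (\<Sum>p\<in>divisor_pairs M. int (card (?S p)))"
    by (subst card_SigmaI[OF finite_divisor_pairs ballI[OF fin]]) (simp only: of_nat_sum)
  finally show ?thesis by (simp add: case_prod_unfold)
qed

text \<open>For A = E the equation reads A(B + F) = 2M, so a = A/2 and e = B + F give M = ae. As A =
  2 modulo 4, the condition on A + B becomes 4 | B.\<close>

lemma cnt_class_V2_diagonal:
  assumes "odd M"
  shows "cnt (2 * M) (\<lambda>A B E F. class_V2 A B E F \<and> A = E)
    = (\<Sum>(a, e)\<in>divisor_pairs M. int (card {B. 0 < B \<and> B < e \<and> 4 dvd B}))"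
proof -
  let ?S = "\<lambda>(a, e). {B. 0 < B \<and> B < e \<and> 4 dvd (B::int)}"
  have fin: "finite (?S p)" for p
    by (rule finite_subset[of _ "{0..snd p}"]) (auto split: prod.splits)
  have "bij_betw (\<lambda>((a, e), B). (2 * a, B, 2 * a, e - B)) (Sigma (divisor_pairs M) ?S)
     (quads (2 * M) (\<lambda>A B E F. class_V2 A B E F \<and> A = E))"
  proof (rule bij_betw_byWitness[where f' = "\<lambda>(A, B, E, F). ((A div 2, B + F), B)"])
    show "\<forall>p\<in>Sigma (divisor_pairs M) ?S. (\<lambda>(A, B, E, F). ((A div 2, B + F), B)) ((\<lambda>((a, e), B). (2 * a, B, 2 * a, e - B)) p) = p"
      by auto
    show "\<forall>q\<in>quads (2 * M) (\<lambda>A B E F. class_V2 A B E F \<and> A = E). (\<lambda>((a, e), B). (2 * a, B, 2 * a, e - B)) ((\<lambda>(A, B, E, F). ((A div 2, B + F), B)) q) = q"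
      by (auto simp: quads_def class_V2_def)
    show "(\<lambda>((a, e), B). (2 * a, B, 2 * a, e - B)) ` Sigma (divisor_pairs M) ?S \<subseteq> quads (2 * M) (\<lambda>A B E F. class_V2 A B E F \<and> A = E)"
    proof clarify
      fix a e B assume p: "(a, e) \<in> divisor_pairs M" and B: "0 < B" "B < e" "4 dvd B"
      have ae: "0 < a" "0 < e" "a * e = M" using p by (auto simp: divisor_pairs_def)
      then have "odd a" "odd e" using assms by auto
      then have "class_V2 (2 * a) B (2 * a) (e - B)" using B(3) unfolding class_V2_def by presburger
      moreover have "2 * a * B + 2 * a * (e - B) = 2 * M" using ae by (auto simp: algebra_simps)
      ultimately show "(2 * a, B, 2 * a, e - B) \<in> quads (2 * M) (\<lambda>A B E F. class_V2 A B E F \<and> A = E)"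
        using B ae by (auto simp: quads_def)
    qed
    show "(\<lambda>(A, B, E, F). ((A div 2, B + F), B)) ` quads (2 * M) (\<lambda>A B E F. class_V2 A B E F \<and> A = E) \<subseteq> Sigma (divisor_pairs M) ?S"
    proof (rule image_subsetI)
      fix p assume p: "p \<in> quads (2 * M) (\<lambda>A B E F. class_V2 A B E F \<and> A = E)"
      obtain A B E F where pq: "p = (A, B, E, F)" by (cases p)
      from p have q': "0 < A" "0 < B" "0 < F" "A * B + A * F = 2 * M" "even A" "4 dvd A + 2" "4 dvd A + B + 2"
        by (auto simp: pq quads_def class_V2_def)
      obtain a where a: "A = 2 * a" using q'(5) by (rule evenE)
      have "2 * (a * (B + F)) = 2 * M" using q'(4) a by (simp add: algebra_simps)
      then have "a * (B + F) = M" by simp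
      moreover have "4 dvd B" using q'(6,7) by presburger
      ultimately show "(\<lambda>(A, B, E, F). ((A div 2, B + F), B)) p \<in> Sigma (divisor_pairs M) ?S"
        using q' a by (auto simp: pq divisor_pairs_def)
    qed
  qed
  then have "cnt (2 * M) (\<lambda>A B E F. class_V2 A B E F \<and> A = E) = int (card (Sigma (divisor_pairs M) ?S))"
    by (simp add: cnt_def bij_betw_same_card)
  also have "\<dots> = (\<Sum>p\<in>divisor_pairs M. int (card (?S p)))"
    by (subst card_SigmaI[OF finite_divisor_pairs ballI[OF fin]]) (simp only: of_nat_sum)
  finally show ?thesis by (simp add: case_prod_unfold)
qed

lemma cnt_diagonals:
  assumes "odd M"
  shows "cnt (2 * M) (\<lambda>A B E F. class_O A B E F \<and> A = F) + 2 * cnt (2 * M) (\<lambda>A B E F. class_V2 A B E F \<and> A = E)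
    + int (card (divisor_pairs M)) = sigma M"
proof -
  let ?c = "\<lambda>a. of_bool (a mod 4 = (3::int)) :: int"
  have "cnt (2 * M) (\<lambda>A B E F. class_O A B E F \<and> A = F) + 2 * cnt (2 * M) (\<lambda>A B E F. class_V2 A B E F \<and> A = E)
      + int (card (divisor_pairs M))
    = (\<Sum>(a, e)\<in>divisor_pairs M. int (card {B. 0 < B \<and> B < 2 * e \<and> odd B \<and> 4 dvd a + B})
        + 2 * int (card {B. 0 < B \<and> B < e \<and> 4 dvd B}) + 1)"
    unfolding cnt_class_O_diagonal[OF assms] cnt_class_V2_diagonal[OF assms]
    by (simp add: sum.distrib sum_distrib_left case_prod_unfold)
  also have "\<dots> = (\<Sum>(a, e)\<in>divisor_pairs M. e + ?c a - ?c e)"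
  proof (rule sum.cong[OF refl], clarify)
    fix a e assume "(a, e) \<in> divisor_pairs M"
    then have "odd a" "odd e" "0 < e" using assms by (auto simp: divisor_pairs_def)
    then show "int (card {B. 0 < B \<and> B < 2 * e \<and> odd B \<and> 4 dvd a + B})
        + 2 * int (card {B. 0 < B \<and> B < e \<and> 4 dvd B}) + 1 = e + ?c a - ?c e"
      by (rule card_diagonal)
  qed
  also have "\<dots> = (\<Sum>(a, e)\<in>divisor_pairs M. e) + (\<Sum>(a, e)\<in>divisor_pairs M. ?c a) - (\<Sum>(a, e)\<in>divisor_pairs M. ?c e)"
    by (simp add: sum.distrib sum_subtractf case_prod_unfold)
  also have "\<dots> = sigma M"
    using sum_divisor_pairs_swap[of "\<lambda>a e. a" M] sum_divisor_pairs_swap[of "\<lambda>a e. ?c a" M]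
    by (simp add: sigma_def)
  finally show ?thesis .
qed

section \<open>Cutting \<open>shifted\<close> into regions of quadruples\<close>

lemma class_O_of_eq:
  fixes A B E F M :: int
  assumes "odd A" "odd B" "odd E" "odd F" "A * B + E * F = 2 * M" "odd M" "4 dvd E + F"
  shows "class_O A B E F"
proof -
  \<comment> \<open>Modulo 4: EF = -E^2 = -1 and 2M = 2, hence AB = -1, which for odd A, B means A =
    -B.\<close>
  obtain a b c d m where v: "A = 2 * a + 1" "B = 2 * b + 1" "E = 2 * c + 1" "F = 2 * d + 1" "M = 2 * m + 1"
    using assms by (metis oddE)
  have "2 * (a * b + c * d) + (a + b + c + d) = 2 * m"
    using assms(5) unfolding v by (simp add: algebra_simps)
  then have "even (a + b + c + d)" by presburger
  moreover have "odd (c + d)" using assms(7) unfolding v by presburger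
  ultimately have "odd (a + b)" by presburger
  then have "4 dvd A + B" unfolding v by presburger
  then show ?thesis using assms by (simp add: class_O_def)
qed

lemma class_V2_of_eq:
  fixes A B E F M :: int
  assumes "even A" "even B" "even E" "odd F" "A * B + E * F = 2 * M" "odd M" "4 dvd A + B - E"
  shows "class_V2 A B E F"
proof -
  \<comment> \<open>Modulo 4: AB = 0 and 2M = 2, hence E = 2, and then A + B = E = 2.\<close>
  obtain a b e where v: "A = 2 * a" "B = 2 * b" "E = 2 * e"
    using assms by (metis evenE)
  have "2 * (a * b) + e * F = M"
    using assms(5) unfolding v by (simp add: algebra_simps)
  then have "odd e" using assms(6) by auto
  then have "4 dvd E + 2" unfolding v by presburger
  moreover from this have "4 dvd A + B + 2" using assms(7) by presburger
  ultimately show ?thesis using assms by (simp add: class_V2_def)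
qed

lemma shifted_iff: "(w, x, y, z) \<in> shifted M \<longleftrightarrow> 0 \<le> x \<and> 0 < y \<and> 0 < z \<and> even x \<and> odd y \<and> even z
    \<and> x * y + y * z + z * x + 4 * w\<^sup>2 = 2 * M"
  by (auto simp: shifted_def triples_def)

text \<open>
  The identities $xy + yz + zx + t^2 = (x + y)(y + z) + (t - y)(t + y)$ and
  $xy + yz + zx + t^2 = (x + t)(z + t) + (x + z)(y - t)$, with $t = 2w$, turn the two cases
  $|t| > y$ and $|t| < y$ into quadruples with positive entries.
\<close>
lemma bij_shifted_large:
  assumes "odd M"
  shows "bij_betw (\<lambda>(w, x, y, z). (x + y, y + z, 2 * w - y, 2 * w + y)) {(w, x, y, z) \<in> shifted M. y < 2 * w}
    (quads (2 * M) (\<lambda>A B E F. class_O A B E F \<and> E < F \<and> F - E \<le> 2 * A \<and> F - E < 2 * B))"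
    (is "bij_betw ?f ?S ?Q")
\<comment> \<open>The inverse reads off w and y from E + F = 4w and F - E = 2y.\<close>
proof (rule bij_betw_byWitness[where f' =
    "\<lambda>(A, B, E, F). ((E + F) div 4, A - (F - E) div 2, (F - E) div 2, B - (F - E) div 2)"])
  show "\<forall>p\<in>?S. (\<lambda>(A, B, E, F). ((E + F) div 4, A - (F - E) div 2, (F - E) div 2, B - (F - E) div 2)) (?f p) = p"
    by auto
  show "\<forall>q\<in>?Q. ?f ((\<lambda>(A, B, E, F). ((E + F) div 4, A - (F - E) div 2, (F - E) div 2, B - (F - E) div 2)) q) = q"
  proof
    fix q assume q: "q \<in> ?Q"
    obtain A B E F where qq: "q = (A, B, E, F)" by (cases q)
    have "4 dvd E + F" using q by (auto simp: qq quads_def class_O_def)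
    then obtain k where k: "F = 4 * k - E" by (metis dvdE add_diff_cancel_left')
    then have "(E + F) div 4 = k" "(F - E) div 2 = 2 * k - E" by auto
    then show "?f ((\<lambda>(A, B, E, F). ((E + F) div 4, A - (F - E) div 2, (F - E) div 2, B - (F - E) div 2)) q) = q"
      using k by (simp add: qq)
  qed
  show "?f ` ?S \<subseteq> ?Q"
  proof (rule image_subsetI)
    fix p assume p: "p \<in> ?S"
    obtain w x y z where pp: "p = (w, x, y, z)" by (cases p)
    have v: "0 \<le> x" "0 < y" "0 < z" "even x" "odd y" "even z" "x * y + y * z + z * x + 4 * w\<^sup>2 = 2 * M" "y < 2 * w"
      using p by (auto simp: pp shifted_iff)
    have eq: "(x + y) * (y + z) + (2 * w - y) * (2 * w + y) = 2 * M"
      using v(7) by (simp add: algebra_simps power2_eq_square)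
    moreover have "class_O (x + y) (y + z) (2 * w - y) (2 * w + y)"
      by (rule class_O_of_eq[OF _ _ _ _ eq assms]) (use v in auto)
    ultimately show "?f p \<in> ?Q" using v by (auto simp: pp quads_def)
  qed
  show "(\<lambda>(A, B, E, F). ((E + F) div 4, A - (F - E) div 2, (F - E) div 2, B - (F - E) div 2)) ` ?Q \<subseteq> ?S"
  proof (rule image_subsetI)
    fix q assume q: "q \<in> ?Q"
    obtain A B E F where qq: "q = (A, B, E, F)" by (cases q)
    have v: "0 < A" "0 < B" "0 < E" "0 < F" "A * B + E * F = 2 * M" "odd A" "odd B" "odd E" "odd F"
        "E < F" "F - E \<le> 2 * A" "F - E < 2 * B" "4 dvd E + F"
      using q by (auto simp: qq quads_def class_O_def)
    then obtain k where k: "F = 4 * k - E" by (metis dvdE add_diff_cancel_left')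
    then have d: "(E + F) div 4 = k" "(F - E) div 2 = 2 * k - E" by auto
    have "(A - (2 * k - E)) * (2 * k - E) + (2 * k - E) * (B - (2 * k - E)) + (B - (2 * k - E)) * (A - (2 * k - E)) + 4 * k\<^sup>2 = 2 * M"
      using v(5) unfolding k by (simp add: algebra_simps power2_eq_square)
    moreover have "0 \<le> A - (2 * k - E)" "0 < 2 * k - E" "0 < B - (2 * k - E)" "2 * k - E < 2 * k"
      using v k by linarith+
    moreover have "even (A - (2 * k - E))" "odd (2 * k - E)" "even (B - (2 * k - E))"
      using v by auto
    ultimately show "(\<lambda>(A, B, E, F). ((E + F) div 4, A - (F - E) div 2, (F - E) div 2, B - (F - E) div 2)) q \<in> ?S"
      by (simp add: qq d shifted_iff)
  qed
qed

lemma bij_shifted_small: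
  assumes "odd M"
  shows "bij_betw (\<lambda>(w, x, y, z). (x + 2 * w, z + 2 * w, x + z, y - 2 * w)) {(w, x, y, z) \<in> shifted M. 2 * w < y \<and> 0 < w}
    (quads (2 * M) (\<lambda>A B E F. class_V2 A B E F \<and> B - A \<le> E \<and> A - B < E \<and> E < A + B))"
    (is "bij_betw ?f ?S ?Q")
\<comment> \<open>Here A + B - E = 4w recovers w, and 2x = A - B + E, 2z = B - A + E. So the three
  inequalities on the target are x >= 0, z > 0 and w > 0, in this order.\<close>
proof (rule bij_betw_byWitness[where f' =
    "\<lambda>(A, B, E, F). ((A + B - E) div 4, A - (A + B - E) div 2, F + (A + B - E) div 2, B - (A + B - E) div 2)"])
  show "\<forall>p\<in>?S. (\<lambda>(A, B, E, F). ((A + B - E) div 4, A - (A + B - E) div 2, F + (A + B - E) div 2, B - (A + B - E) div 2)) (?f p) = p"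
    by auto
  have dvd: "4 dvd A + B - E" if "class_V2 A B E F" for A B E F
    using that unfolding class_V2_def by presburger
  show "\<forall>q\<in>?Q. ?f ((\<lambda>(A, B, E, F). ((A + B - E) div 4, A - (A + B - E) div 2, F + (A + B - E) div 2, B - (A + B - E) div 2)) q) = q"
  proof
    fix q assume q: "q \<in> ?Q"
    obtain A B E F where qq: "q = (A, B, E, F)" by (cases q)
    have "4 dvd A + B - E" using q dvd by (auto simp: qq quads_def)
    then obtain k where "A + B - E = 4 * k" by (rule dvdE)
    then have k: "E = A + B - 4 * k" by simp
    then have "(A + B - E) div 4 = k" "(A + B - E) div 2 = 2 * k" by auto
    then show "?f ((\<lambda>(A, B, E, F). ((A + B - E) div 4, A - (A + B - E) div 2, F + (A + B - E) div 2, B - (A + B - E) div 2)) q) = q"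
      using k by (simp add: qq)
  qed
  show "?f ` ?S \<subseteq> ?Q"
  proof (rule image_subsetI)
    fix p assume p: "p \<in> ?S"
    obtain w x y z where pp: "p = (w, x, y, z)" by (cases p)
    have v: "0 \<le> x" "0 < y" "0 < z" "even x" "odd y" "even z" "x * y + y * z + z * x + 4 * w\<^sup>2 = 2 * M" "2 * w < y" "0 < w"
      using p by (auto simp: pp shifted_iff)
    have eq: "(x + 2 * w) * (z + 2 * w) + (x + z) * (y - 2 * w) = 2 * M"
      using v(7) by (simp add: algebra_simps power2_eq_square)
    moreover have "class_V2 (x + 2 * w) (z + 2 * w) (x + z) (y - 2 * w)"
      by (rule class_V2_of_eq[OF _ _ _ _ eq assms]) (use v in auto)
    ultimately show "?f p \<in> ?Q" using v by (auto simp: pp quads_def)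
  qed
  show "(\<lambda>(A, B, E, F). ((A + B - E) div 4, A - (A + B - E) div 2, F + (A + B - E) div 2, B - (A + B - E) div 2)) ` ?Q \<subseteq> ?S"
  proof (rule image_subsetI)
    fix q assume q: "q \<in> ?Q"
    obtain A B E F where qq: "q = (A, B, E, F)" by (cases q)
    have v: "0 < A" "0 < B" "0 < E" "0 < F" "A * B + E * F = 2 * M" "even A" "even B" "odd F"
        "B - A \<le> E" "A - B < E" "E < A + B" "4 dvd A + B - E"
      using q dvd by (auto simp: qq quads_def class_V2_def)
    obtain k where "A + B - E = 4 * k" using v(12) by (rule dvdE)
    then have k: "E = A + B - 4 * k" by simp
    then have d: "(A + B - E) div 4 = k" "(A + B - E) div 2 = 2 * k" by auto
    have "(A - 2 * k) * (F + 2 * k) + (F + 2 * k) * (B - 2 * k) + (B - 2 * k) * (A - 2 * k) + 4 * k\<^sup>2 = 2 * M"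
      using v(5) unfolding k by (simp add: algebra_simps power2_eq_square)
    moreover have "0 \<le> A - 2 * k" "0 < F + 2 * k" "0 < B - 2 * k" "2 * k < F + 2 * k" "0 < k"
      using v k by linarith+
    moreover have "even (A - 2 * k)" "odd (F + 2 * k)" "even (B - 2 * k)"
      using v by auto
    ultimately show "(\<lambda>(A, B, E, F). ((A + B - E) div 4, A - (A + B - E) div 2, F + (A + B - E) div 2, B - (A + B - E) div 2)) q \<in> ?S"
      by (simp add: qq d shifted_iff)
  qed
qed

text \<open>At w = 0 the second identity becomes xz + (x + z)y, whence E = A + B; x > 0 is needed
  for a positive entry A.\<close>

lemma bij_shifted_zero:
  assumes "odd M"
  shows "bij_betw (\<lambda>(w, x, y, z). (x, z, x + z, y)) {(w, x, y, z) \<in> shifted M. w = 0 \<and> 0 < x}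
    (quads (2 * M) (\<lambda>A B E F. class_V2 A B E F \<and> E = A + B))"
    (is "bij_betw ?f ?S ?Q")
proof (rule bij_betw_byWitness[where f' = "\<lambda>(A, B, E, F). (0, A, F, B)"])
  show "?f ` ?S \<subseteq> ?Q"
  proof (rule image_subsetI)
    fix p assume p: "p \<in> ?S"
    obtain w x y z where pp: "p = (w, x, y, z)" by (cases p)
    have v: "0 < x" "0 < y" "0 < z" "even x" "odd y" "even z" "x * y + y * z + z * x = 2 * M" "w = 0"
      using p by (auto simp: pp shifted_iff)
    have eq: "x * z + (x + z) * y = 2 * M"
      using v(7) by (simp add: algebra_simps)
    moreover have "class_V2 x z (x + z) y"
      by (rule class_V2_of_eq[OF _ _ _ _ eq assms]) (use v in auto)
    ultimately show "?f p \<in> ?Q" using v by (auto simp: pp quads_def)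
  qed
qed (auto simp: quads_def shifted_iff class_V2_def algebra_simps)

text \<open>What is left is yz = 2M with y odd, so z is even and there is one solution for each
  factorization of M.\<close>

lemma bij_shifted_degenerate:
  assumes "odd M"
  shows "bij_betw (\<lambda>(w, x, y, z). (y, z div 2)) {(w, x, y, z) \<in> shifted M. w = 0 \<and> x = 0} (divisor_pairs M)"
  by (rule bij_betw_byWitness[where f' = "\<lambda>(y, z). (0, 0, y, 2 * z)"])
     (use assms in \<open>auto simp: divisor_pairs_def shifted_iff elim!: evenE\<close>)

lemma bij_shifted_uminus:
  "bij_betw (\<lambda>(w, x, y, z). (- w, x, y, z)) {(w, x, y, z) \<in> shifted M. P (- w) x y z} {(w, x, y, z) \<in> shifted M. P w x y z}"
  by (rule bij_betw_byWitness[where f' = "\<lambda>(w, x, y, z). (- w, x, y, z)"]) (auto simp: shifted_iff)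

text \<open>The regions with w > 0 are doubled by w -> -w, so the total is the left side of
  \<open>cnt_balance\<close> plus one for each factorization of M. The diagonals on its right side,
  together with these, give sigma(M).\<close>

lemma card_shifted:
  assumes "odd M"
  shows "finite (shifted M)" and "int (card (shifted M)) = sigma M"
proof -
  let ?R = "\<lambda>P. {(w, x, y, z) \<in> shifted M. P w x y z}"
  let ?X = "quads (2 * M) (\<lambda>A B E F. class_O A B E F \<and> E < F \<and> F - E \<le> 2 * A \<and> F - E < 2 * B)"
  let ?Y = "quads (2 * M) (\<lambda>A B E F. class_V2 A B E F \<and> B - A \<le> E \<and> A - B < E \<and> E < A + B)"
  let ?Z = "quads (2 * M) (\<lambda>A B E F. class_V2 A B E F \<and> E = A + B)"
  define R1 where "R1 = ?R (\<lambda>w x y z. y < 2 * w)"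
  define R2 where "R2 = ?R (\<lambda>w x y z. y < 2 * (- w))"
  define R3 where "R3 = ?R (\<lambda>w x y z. 2 * w < y \<and> 0 < w)"
  define R4 where "R4 = ?R (\<lambda>w x y z. 2 * (- w) < y \<and> 0 < - w)"
  define R5 where "R5 = ?R (\<lambda>w x y z. w = 0 \<and> 0 < x)"
  define R6 where "R6 = ?R (\<lambda>w x y z. w = 0 \<and> x = 0)"
  have b1: "bij_betw (\<lambda>(w, x, y, z). (x + y, y + z, 2 * w - y, 2 * w + y)) R1 ?X"
    unfolding R1_def by (rule bij_shifted_large[OF assms])
  have b2: "bij_betw (\<lambda>(w, x, y, z). (- w, x, y, z)) R2 R1"
    unfolding R1_def R2_def by (rule bij_shifted_uminus)
  have b3: "bij_betw (\<lambda>(w, x, y, z). (x + 2 * w, z + 2 * w, x + z, y - 2 * w)) R3 ?Y"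
    unfolding R3_def by (rule bij_shifted_small[OF assms])
  have b4: "bij_betw (\<lambda>(w, x, y, z). (- w, x, y, z)) R4 R3"
    unfolding R3_def R4_def by (rule bij_shifted_uminus)
  have b5: "bij_betw (\<lambda>(w, x, y, z). (x, z, x + z, y)) R5 ?Z"
    unfolding R5_def by (rule bij_shifted_zero[OF assms])
  have b6: "bij_betw (\<lambda>(w, x, y, z). (y, z div 2)) R6 (divisor_pairs M)"
    unfolding R6_def by (rule bij_shifted_degenerate[OF assms])
  have f1: "finite R1" using bij_betw_finite[OF b1] finite_quads by blast
  have f3: "finite R3" using bij_betw_finite[OF b3] finite_quads by blast
  have f5: "finite R5" using bij_betw_finite[OF b5] finite_quads by blast
  have f6: "finite R6" using bij_betw_finite[OF b6] finite_divisor_pairs by blast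
  have f2: "finite R2" using bij_betw_finite[OF b2] f1 by blast
  have f4: "finite R4" using bij_betw_finite[OF b4] f3 by blast
  note f = f1 f2 f3 f4 f5 f6
  have U: "shifted M = R1 \<union> (R2 \<union> (R3 \<union> (R4 \<union> (R5 \<union> R6))))"
  proof -
    have "p \<in> R1 \<union> (R2 \<union> (R3 \<union> (R4 \<union> (R5 \<union> R6))))" if "p \<in> shifted M" for p
    proof -
      obtain w x y z where pp: "p = (w, x, y, z)" by (cases p)
      have "0 \<le> x" "0 < y" "odd y" using that by (auto simp: pp shifted_iff)
      \<comment> \<open>An odd y never lies on the boundary |2w| = y between the two
        identities.\<close>
      moreover from this have "y \<noteq> 2 * w" "y \<noteq> 2 * (- w)" by auto
      ultimately show ?thesis
        using that unfolding R1_def R2_def R3_def R4_def R5_def R6_def pp by auto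
    qed
    then show ?thesis unfolding R1_def R2_def R3_def R4_def R5_def R6_def by blast
  qed
  show "finite (shifted M)" using U f by simp
  have pos: "0 < y" if "(w, x, y, z) \<in> shifted M" for w x y z using that by (simp add: shifted_iff)
  have "card (shifted M) = card R1 + (card R2 + (card R3 + (card R4 + (card R5 + card R6))))"
  proof -
    have "R1 \<inter> (R2 \<union> (R3 \<union> (R4 \<union> (R5 \<union> R6)))) = {}" "R2 \<inter> (R3 \<union> (R4 \<union> (R5 \<union> R6))) = {}"
      "R3 \<inter> (R4 \<union> (R5 \<union> R6)) = {}" "R4 \<inter> (R5 \<union> R6) = {}" "R5 \<inter> R6 = {}"
      by (auto simp: R1_def R2_def R3_def R4_def R5_def R6_def dest: pos)
    then show ?thesis unfolding U using f by (simp add: card_Un_disjoint)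
  qed
  also have "\<dots> = 2 * card ?X + 2 * card ?Y + card ?Z + card (divisor_pairs M)"
    using b1 b2 b3 b4 b5 b6 by (simp add: bij_betw_same_card)
  finally have "int (card (shifted M)) = 2 * int (card ?X) + 2 * int (card ?Y) + int (card ?Z) + int (card (divisor_pairs M))"
    by simp
  then show "int (card (shifted M)) = sigma M"
    using cnt_balance[of "2 * M"] cnt_diagonals[OF assms] unfolding cnt_def by linarith
qed

section \<open>Four odd squares\<close>

text \<open>The triples on which the involutions of Heath-Brown and Zagier act in their proofs of
  the two-squares theorem; here x may have either sign.\<close>

definition windmills :: "int \<Rightarrow> (int \<times> int \<times> int) set" where
  "windmills k = {(x, y, z). 0 < y \<and> 0 < z \<and> x\<^sup>2 + 4 * y * z = k}"

lemma abs_le_square: "\<bar>s\<bar> \<le> (s::int)\<^sup>2"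
  using mult_right_mono[of 1 "\<bar>s\<bar>" "\<bar>s\<bar>"] by (cases "s = 0") (auto simp: power2_eq_square)

lemma finite_windmills: "finite (windmills k)"
proof (rule finite_subset)
  show "windmills k \<subseteq> {-k..k} \<times> {0..k} \<times> {0..k}"
  proof (clarsimp simp: windmills_def)
    fix x y z :: int assume "0 < y" "0 < z"
    then have "y \<le> y * z" "z \<le> y * z" using factor_le_mult[of y z] factor_le_mult[of z y] by (simp_all add: mult.commute)
    moreover have "0 \<le> x\<^sup>2" "\<bar>x\<bar> \<le> x\<^sup>2" using abs_le_square by simp_all
    ultimately show "- (x\<^sup>2) - 4 * y * z \<le> x \<and> x \<le> x\<^sup>2 + 4 * y * z \<and> y \<le> x\<^sup>2 + 4 * y * z \<and> z \<le> x\<^sup>2 + 4 * y * z"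
      using \<open>0 < y\<close> \<open>0 < z\<close> by (simp only: mult.assoc) linarith
  qed
qed auto

lemma odd_square_mod_8:
  assumes "odd (n::int)"
  shows "n\<^sup>2 mod 8 = 1"
proof -
  obtain t where t: "n = 2 * t + 1" using assms by (rule oddE)
  obtain u where "t * (t + 1) = 2 * u" by (metis evenE even_mult_iff odd_even_add odd_one)
  then have "n\<^sup>2 = 8 * u + 1" by (simp add: t power2_eq_square algebra_simps)
  then show ?thesis by presburger
qed

text \<open>
  Up to terms that cancel under $x \mapsto -x$ and $y \leftrightarrow z$, the summand is half of
  $(y + z)(x + y)(z - x)$, which changes sign under a Zagier-type involution of the part $z < x + y$.
\<close>
lemma windmill_sum:
  assumes "k mod 8 = 5"
  shows "(\<Sum>(x, y, z)\<in>windmills k. (y * z - x\<^sup>2) * y) = 0"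
proof -
  let ?S = "windmills k"
  let ?g = "\<lambda>x y z. (y + z) * (x + y) * (z - x) :: int"
  let ?Sp = "{(x, y, z) \<in> ?S. z < x + y}"
  let ?Sm = "{(x, y, z) \<in> ?S. x + y < z}"
  have swap: "(\<Sum>(x, y, z)\<in>?S. (y * z - x\<^sup>2) * z) = (\<Sum>(x, y, z)\<in>?S. (y * z - x\<^sup>2) * y)"
    by (rule sum.reindex_bij_witness[of _ "\<lambda>(x, y, z). (x, z, y)" "\<lambda>(x, y, z). (x, z, y)"])
       (auto simp: windmills_def algebra_simps)
  have neg: "(\<Sum>(x, y, z)\<in>?S. x * (y\<^sup>2 - z\<^sup>2)) = (\<Sum>(x, y, z)\<in>?S. - (x * (y\<^sup>2 - z\<^sup>2)))"
    by (rule sum.reindex_bij_witness[of _ "\<lambda>(x, y, z). (- x, y, z)" "\<lambda>(x, y, z). (- x, y, z)"])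
       (auto simp: windmills_def algebra_simps)
  have "(\<Sum>(x, y, z)\<in>?S. ?g x y z)
      = (\<Sum>(x, y, z)\<in>?S. (y * z - x\<^sup>2) * y + (y * z - x\<^sup>2) * z - x * (y\<^sup>2 - z\<^sup>2))"
    by (rule sum.cong) (auto simp: algebra_simps power2_eq_square)
  also have "\<dots> = (\<Sum>(x, y, z)\<in>?S. (y * z - x\<^sup>2) * y) + (\<Sum>(x, y, z)\<in>?S. (y * z - x\<^sup>2) * z)
      - (\<Sum>(x, y, z)\<in>?S. x * (y\<^sup>2 - z\<^sup>2))"
    by (simp add: sum.distrib sum_subtractf case_prod_unfold)
  also have "(\<Sum>(x, y, z)\<in>?S. x * (y\<^sup>2 - z\<^sup>2)) = 0"
    using neg by (simp add: sum_negf case_prod_unfold)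
  finally have g: "(\<Sum>(x, y, z)\<in>?S. ?g x y z) = 2 * (\<Sum>(x, y, z)\<in>?S. (y * z - x\<^sup>2) * y)"
    using swap by simp
  \<comment> \<open>On the boundary, k would be the odd square (x + 2y)^2, which is 1 modulo
    8.\<close>
  have "z \<noteq> x + y" if "(x, y, z) \<in> ?S" for x y z
  proof
    assume "z = x + y"
    with that have "k = (x + 2 * y)\<^sup>2" by (auto simp: windmills_def power2_eq_square algebra_simps)
    moreover have "odd k" using assms by presburger
    ultimately have "k mod 8 = 1" by (simp add: odd_square_mod_8)
    then show False using assms by simp
  qed
  then have un: "?Sp \<union> ?Sm = ?S" by force
  have disj: "?Sp \<inter> ?Sm = {}" by auto
  have fin: "finite ?Sp" "finite ?Sm"
    by (rule finite_subset[OF _ finite_windmills[of k]], blast)+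
  have "(\<Sum>(x, y, z)\<in>?S. ?g x y z) = (\<Sum>(x, y, z)\<in>?Sp. ?g x y z) + (\<Sum>(x, y, z)\<in>?Sm. ?g x y z)"
    using sum.union_disjoint[OF fin disj, of "\<lambda>(x, y, z). ?g x y z"] unfolding un .
  \<comment> \<open>Negating x and swapping y, z exchanges the two parts and permutes the factors of
    \<open>?g\<close>.\<close>
  moreover have "(\<Sum>(x, y, z)\<in>?Sm. ?g x y z) = (\<Sum>(x, y, z)\<in>?Sp. ?g x y z)"
    by (rule sum.reindex_bij_witness[of _ "\<lambda>(x, y, z). (- x, z, y)" "\<lambda>(x, y, z). (- x, z, y)"])
       (auto simp: windmills_def algebra_simps)
  \<comment> \<open>The involution exchanges y + z with x + y and negates z - x.\<close>
  moreover have "(\<Sum>(x, y, z)\<in>?Sp. ?g x y z) = (\<Sum>(x, y, z)\<in>?Sp. - ?g x y z)"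
    by (rule sum.reindex_bij_witness[of _ "\<lambda>(x, y, z). (2 * z - x, x + y - z, z)" "\<lambda>(x, y, z). (2 * z - x, x + y - z, z)"])
       (auto simp: windmills_def algebra_simps power2_eq_square)
  moreover have "(\<Sum>(x, y, z)\<in>?Sp. - ?g x y z) = - (\<Sum>(x, y, z)\<in>?Sp. ?g x y z)"
    by (simp add: sum_negf case_prod_unfold)
  ultimately show ?thesis using g by linarith
qed

section \<open>Matching recurrences for the divisor sum and for four odd squares\<close>

definition odd_roots :: "int \<Rightarrow> int set" where
  "odd_roots k = {s. odd s \<and> s\<^sup>2 \<le> k}"

definition odd_squares :: "int \<Rightarrow> (int \<times> int \<times> int \<times> int) set" where
  "odd_squares k = {(a, b, c, d). odd a \<and> odd b \<and> odd c \<and> odd d \<and> a\<^sup>2 + b\<^sup>2 + c\<^sup>2 + d\<^sup>2 = k}"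

lemma finite_odd_roots: "finite (odd_roots k)"
proof (rule finite_subset)
  show "odd_roots k \<subseteq> {-k..k}"
  proof
    fix s assume "s \<in> odd_roots k"
    then show "s \<in> {-k..k}" using abs_le_square[of s] by (simp add: odd_roots_def) linarith
  qed
qed auto

lemma finite_odd_squares: "finite (odd_squares k)"
proof (rule finite_subset)
  show "odd_squares k \<subseteq> odd_roots k \<times> odd_roots k \<times> odd_roots k \<times> odd_roots k"
    by (auto simp: odd_squares_def odd_roots_def)
qed (auto simp: finite_odd_roots)

text \<open>On a windmill, 4(yz - x^2) = k - 5x^2, and for fixed x = s the sum of y over yz = (k -
  s^2)/4 is a value of \<open>sigma\<close>.\<close>

lemma sum_windmills:
  assumes "k mod 8 = 5"
  shows "(\<Sum>s\<in>odd_roots k. (k - 5 * s\<^sup>2) * sigma ((k - s\<^sup>2) div 4)) = 0"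
proof -
  let ?T = "SIGMA s:odd_roots k. divisor_pairs ((k - s\<^sup>2) div 4)"
  have "(\<Sum>s\<in>odd_roots k. (k - 5 * s\<^sup>2) * sigma ((k - s\<^sup>2) div 4))
      = (\<Sum>s\<in>odd_roots k. \<Sum>(y, z)\<in>divisor_pairs ((k - s\<^sup>2) div 4). (k - 5 * s\<^sup>2) * y)"
    by (simp add: sigma_def sum_distrib_left case_prod_unfold)
  also have "\<dots> = (\<Sum>(s, y, z)\<in>?T. (k - 5 * s\<^sup>2) * y)"
    by (subst sum.Sigma) (auto simp: finite_odd_roots finite_divisor_pairs case_prod_unfold)
  also have "\<dots> = (\<Sum>(x, y, z)\<in>windmills k. 4 * ((y * z - x\<^sup>2) * y))"
  proof (rule sum.cong)
    show "?T = windmills k"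
    proof (intro set_eqI iffI)
      fix p assume p: "p \<in> ?T"
      obtain x y z where pp: "p = (x, y, z)" by (cases p)
      have v: "odd x" "0 < y" "0 < z" "y * z = (k - x\<^sup>2) div 4" using p by (auto simp: pp odd_roots_def divisor_pairs_def)
      have "k - x\<^sup>2 = 4 * (y * z)" using v(4) odd_square_mod_8[OF v(1)] assms by presburger
      then show "p \<in> windmills k" using v by (simp add: pp windmills_def)
    next
      fix p assume p: "p \<in> windmills k"
      obtain x y z where pp: "p = (x, y, z)" by (cases p)
      have v: "0 < y" "0 < z" "x\<^sup>2 + 4 * (y * z) = k" using p by (auto simp: pp windmills_def)
      have "odd k" using assms by presburger
      then have "odd (x\<^sup>2)" unfolding v(3)[symmetric] by simp
      moreover have "0 < y * z" using v by simp
      ultimately show "p \<in> ?T" using v by (auto simp: pp odd_roots_def divisor_pairs_def)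
    qed
  qed (auto simp: windmills_def algebra_simps)
  also have "\<dots> = 0"
    using windmill_sum[OF assms] by (simp add: sum_distrib_left[symmetric] case_prod_unfold)
  finally show ?thesis .
qed

text \<open>
  Group the solutions of $k = s^2 + a^2 + b^2 + c^2 + d^2$ by $s$: on average $s^2$ is $k/5$.
\<close>
lemma sum_odd_squares:
  "(\<Sum>s\<in>odd_roots k. (k - 5 * s\<^sup>2) * int (card (odd_squares (k - s\<^sup>2)))) = 0"
proof -
  let ?T = "{(s, a, b, c, d). odd s \<and> odd a \<and> odd b \<and> odd c \<and> odd d \<and> s\<^sup>2 + a\<^sup>2 + b\<^sup>2 + c\<^sup>2 + d\<^sup>2 = (k::int)}"
  have T: "?T = (SIGMA s:odd_roots k. odd_squares (k - s\<^sup>2))"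
    by (auto simp: odd_roots_def odd_squares_def)
  have a: "(\<Sum>(s, a, b, c, d)\<in>?T. a\<^sup>2) = (\<Sum>(s, a, b, c, d)\<in>?T. s\<^sup>2)"
    by (rule sum.reindex_bij_witness[of _ "\<lambda>(s, a, b, c, d). (a, s, b, c, d)" "\<lambda>(s, a, b, c, d). (a, s, b, c, d)"]) auto
  have b: "(\<Sum>(s, a, b, c, d)\<in>?T. b\<^sup>2) = (\<Sum>(s, a, b, c, d)\<in>?T. s\<^sup>2)"
    by (rule sum.reindex_bij_witness[of _ "\<lambda>(s, a, b, c, d). (b, a, s, c, d)" "\<lambda>(s, a, b, c, d). (b, a, s, c, d)"]) auto
  have c: "(\<Sum>(s, a, b, c, d)\<in>?T. c\<^sup>2) = (\<Sum>(s, a, b, c, d)\<in>?T. s\<^sup>2)"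
    by (rule sum.reindex_bij_witness[of _ "\<lambda>(s, a, b, c, d). (c, a, b, s, d)" "\<lambda>(s, a, b, c, d). (c, a, b, s, d)"]) auto
  have d: "(\<Sum>(s, a, b, c, d)\<in>?T. d\<^sup>2) = (\<Sum>(s, a, b, c, d)\<in>?T. s\<^sup>2)"
    by (rule sum.reindex_bij_witness[of _ "\<lambda>(s, a, b, c, d). (d, a, b, c, s)" "\<lambda>(s, a, b, c, d). (d, a, b, c, s)"]) auto
  have "(\<Sum>s\<in>odd_roots k. (k - 5 * s\<^sup>2) * int (card (odd_squares (k - s\<^sup>2))))
      = (\<Sum>s\<in>odd_roots k. \<Sum>q\<in>odd_squares (k - s\<^sup>2). k - 5 * s\<^sup>2)"
    by (simp add: mult.commute)
  also have "\<dots> = (\<Sum>(s, a, b, c, d)\<in>?T. k - 5 * s\<^sup>2)"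
    unfolding T by (subst sum.Sigma) (auto simp: finite_odd_roots finite_odd_squares case_prod_unfold)
  also have "\<dots> = (\<Sum>(s, a, b, c, d)\<in>?T. a\<^sup>2 + b\<^sup>2 + c\<^sup>2 + d\<^sup>2 - 4 * s\<^sup>2)"
    by (rule sum.cong) auto
  also have "\<dots> = (\<Sum>(s, a, b, c, d)\<in>?T. a\<^sup>2) + (\<Sum>(s, a, b, c, d)\<in>?T. b\<^sup>2) + (\<Sum>(s, a, b, c, d)\<in>?T. c\<^sup>2)
      + (\<Sum>(s, a, b, c, d)\<in>?T. d\<^sup>2) - 4 * (\<Sum>(s, a, b, c, d)\<in>?T. s\<^sup>2)"
    by (simp add: sum.distrib sum_subtractf sum_distrib_left case_prod_unfold)
  also have "\<dots> = 0" unfolding a b c d by simp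
  finally show ?thesis .
qed

lemma odd_roots_gap:
  assumes "odd (s::int)" "s \<noteq> 1" "s \<noteq> -1"
  shows "1 < s\<^sup>2"
proof -
  have "1 < \<bar>s\<bar>" using assms by (cases "s = 0") auto
  then show ?thesis using abs_le_square[of s] by linarith
qed

text \<open>Both sides satisfy the recurrence given by \<open>sum_windmills\<close> and
  \<open>sum_odd_squares\<close> at k = 4N + 1, so their difference \<open>?D\<close> does too. By
  induction only s = 1 and s = -1 contribute, each with the factor k - 5 = 4N - 4; it vanishes at N
  = 1, which is therefore the base case.\<close>

lemma card_four_odd_squares:
  assumes "odd N" "0 < N"
  shows "int (card (odd_squares (4 * N))) = 16 * sigma N"
  using assms
proof (induction "nat N" arbitrary: N rule: less_induct)
  case less
  let ?D = "\<lambda>j. int (card (odd_squares (4 * j))) - 16 * sigma j"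
  show ?case
  proof (cases "N = 1")
    case True
    have "odd_squares 4 = {-1, 1} \<times> {-1, 1} \<times> {-1, 1} \<times> {-1, 1}"
    proof (intro set_eqI iffI)
      fix q assume q: "q \<in> odd_squares 4"
      obtain a b c d where qq: "q = (a, b, c, d)" by (cases q)
      have o: "odd a" "odd b" "odd c" "odd d" and eq: "a\<^sup>2 + b\<^sup>2 + c\<^sup>2 + d\<^sup>2 = 4"
        using q by (auto simp: qq odd_squares_def)
      have ge: "1 \<le> u\<^sup>2" if "odd u" for u :: int
        using odd_roots_gap[OF that] by (cases "u = 1 \<or> u = -1") auto
      have "\<not> 1 < a\<^sup>2" "\<not> 1 < b\<^sup>2" "\<not> 1 < c\<^sup>2" "\<not> 1 < d\<^sup>2"
        using ge[OF o(1)] ge[OF o(2)] ge[OF o(3)] ge[OF o(4)] eq by linarith+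
      then have "a \<in> {-1, 1}" "b \<in> {-1, 1}" "c \<in> {-1, 1}" "d \<in> {-1, 1}"
        using o odd_roots_gap by blast+
      then show "q \<in> {-1, 1} \<times> {-1, 1} \<times> {-1, 1} \<times> {-1, 1}"
        unfolding qq by blast
    qed (auto simp: odd_squares_def)
    moreover have "divisor_pairs 1 = {(1, 1)}"
      using pos_zmult_eq_1_iff by (auto simp: divisor_pairs_def)
    ultimately show ?thesis using True by (simp add: sigma_def)
  next
    case False
    define k where "k = 4 * N + 1"
    have k: "k mod 8 = 5" using less.prems unfolding k_def by presburger
    have "(\<Sum>s\<in>odd_roots k. (k - 5 * s\<^sup>2) * ?D ((k - s\<^sup>2) div 4))
        = (\<Sum>s\<in>odd_roots k. (k - 5 * s\<^sup>2) * int (card (odd_squares (k - s\<^sup>2))))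
          - 16 * (\<Sum>s\<in>odd_roots k. (k - 5 * s\<^sup>2) * sigma ((k - s\<^sup>2) div 4))"
    proof -
      have "4 * ((k - s\<^sup>2) div 4) = k - s\<^sup>2" if "s \<in> odd_roots k" for s
        using that k odd_square_mod_8[of s] unfolding odd_roots_def by simp presburger
      then show ?thesis
        by (simp add: right_diff_distrib sum_subtractf sum_distrib_left mult.left_commute cong: sum.cong)
    qed
    then have zero: "(\<Sum>s\<in>odd_roots k. (k - 5 * s\<^sup>2) * ?D ((k - s\<^sup>2) div 4)) = 0"
      by (simp add: sum_odd_squares sum_windmills[OF k])
    have vanish: "(k - 5 * s\<^sup>2) * ?D ((k - s\<^sup>2) div 4) = 0" if s: "s \<in> odd_roots k - {1, -1}" for s
    proof -
      have s': "odd s" "s\<^sup>2 \<le> k" "1 < s\<^sup>2" using s odd_roots_gap by (auto simp: odd_roots_def)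
      \<comment> \<open>Both k = 5 and s^2 = 1 modulo 8, so k - s^2 = 4 modulo 8 and j is odd; s^2 >
        1 gives j < N.\<close>
      define j where "j = (k - s\<^sup>2) div 4"
      have "odd j" "0 < j" "j < N"
        using s'(2,3) odd_square_mod_8[OF s'(1)] k unfolding j_def k_def by presburger+
      then have "?D j = 0" using less.hyps[of j] by simp
      then show ?thesis by (simp add: j_def)
    qed
    have "{1, -1} \<subseteq> odd_roots k" using less.prems by (simp add: odd_roots_def k_def)
    then have "(\<Sum>s\<in>odd_roots k. (k - 5 * s\<^sup>2) * ?D ((k - s\<^sup>2) div 4))
        = (\<Sum>s\<in>{1, -1}. (k - 5 * s\<^sup>2) * ?D ((k - s\<^sup>2) div 4))"
      by (rule sum.mono_neutral_right[OF finite_odd_roots]) (use vanish in blast)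
    also have "\<dots> = 2 * ((4 * N - 4) * ?D N)" by (simp add: k_def)
    finally show ?thesis using zero False by simp
  qed
qed

section \<open>Three squares and the quaternary form\<close>

definition ternary :: "int \<Rightarrow> (int \<times> int \<times> int) set" where
  "ternary m = {(a, b, c). odd a \<and> odd b \<and> even c \<and> a\<^sup>2 + b\<^sup>2 + c\<^sup>2 = 2 * m}"

definition quaternary :: "int \<Rightarrow> (int \<times> int \<times> int \<times> int) set" where
  "quaternary M = {(w, t). t \<in> ternary (M - 2 * w\<^sup>2)}"

lemma quaternary_iff: "(w, a, b, c) \<in> quaternary M \<longleftrightarrow> odd a \<and> odd b \<and> even c \<and> a\<^sup>2 + b\<^sup>2 + c\<^sup>2 + 4 * w\<^sup>2 = 2 * M"
  by (auto simp: quaternary_def ternary_def)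

text \<open>Writing the four odd numbers as p + q, p - q, r + s, r - s halves the sum of squares to
  2M, with exactly one odd number in each of the pairs p, q and r, s. Making p and r odd costs a
  factor 2 for each pair, and the even s is then 2w.\<close>

lemma card_quaternary:
  shows "card (odd_squares (4 * M)) = 4 * card (quaternary M)" and "finite (quaternary M)"
proof -
  define H :: "(int \<Rightarrow> int \<Rightarrow> int \<Rightarrow> int \<Rightarrow> bool) \<Rightarrow> (int \<times> int \<times> int \<times> int) set" where
    "H P = {(p, q, r, s). odd (p + q) \<and> odd (r + s) \<and> p\<^sup>2 + q\<^sup>2 + r\<^sup>2 + s\<^sup>2 = 2 * M \<and> P p q r s}" for P
  have b1: "bij_betw (\<lambda>(p, q, r, s). (p + q, p - q, r + s, r - s)) (H (\<lambda>_ _ _ _. True)) (odd_squares (4 * M))"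
  proof (rule bij_betw_byWitness[where f' = "\<lambda>(a, b, c, d). ((a + b) div 2, (a - b) div 2, (c + d) div 2, (c - d) div 2)"])
    have half: "\<exists>p q. a = p + q \<and> b = p - q" if "odd a" "odd b" for a b :: int
    proof -
      obtain i where i: "a = 2 * i + 1" using \<open>odd a\<close> by (rule oddE)
      obtain j where j: "b = 2 * j + 1" using \<open>odd b\<close> by (rule oddE)
      have "a = (i + j + 1) + (i - j)" "b = (i + j + 1) - (i - j)" using i j by simp_all
      then show ?thesis by blast
    qed
    have "(\<lambda>(a, b, c, d). ((a + b) div 2, (a - b) div 2, (c + d) div 2, (c - d) div 2)) t \<in> H (\<lambda>_ _ _ _. True)
      \<and> (\<lambda>(p, q, r, s). (p + q, p - q, r + s, r - s))
        ((\<lambda>(a, b, c, d). ((a + b) div 2, (a - b) div 2, (c + d) div 2, (c - d) div 2)) t) = t"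
      if t: "t \<in> odd_squares (4 * M)" for t
    proof -
      obtain a b c d where tt: "t = (a, b, c, d)" by (cases t)
      have v: "odd a" "odd b" "odd c" "odd d" "a\<^sup>2 + b\<^sup>2 + c\<^sup>2 + d\<^sup>2 = 4 * M" using t by (auto simp: tt odd_squares_def)
      obtain p q r s where h: "a = p + q" "b = p - q" "c = r + s" "d = r - s"
        using half[OF v(1,2)] half[OF v(3,4)] by blast
      have d: "(a + b) div 2 = p" "(a - b) div 2 = q" "(c + d) div 2 = r" "(c - d) div 2 = s"
        unfolding h by simp_all
      have "p\<^sup>2 + q\<^sup>2 + r\<^sup>2 + s\<^sup>2 = 2 * M"
        using v(5) unfolding h by (simp add: power2_eq_square algebra_simps)
      moreover have "odd (p + q)" "odd (r + s)" using v(1,3) unfolding h .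
      ultimately show ?thesis unfolding tt by (simp add: d) (simp add: H_def h)
    qed
    then show "(\<lambda>(a, b, c, d). ((a + b) div 2, (a - b) div 2, (c + d) div 2, (c - d) div 2)) ` odd_squares (4 * M) \<subseteq> H (\<lambda>_ _ _ _. True)"
      "\<forall>t\<in>odd_squares (4 * M). (\<lambda>(p, q, r, s). (p + q, p - q, r + s, r - s))
        ((\<lambda>(a, b, c, d). ((a + b) div 2, (a - b) div 2, (c + d) div 2, (c - d) div 2)) t) = t"
      by blast+
  qed (auto simp: H_def odd_squares_def power2_eq_square algebra_simps)
  have fin: "finite (H P)" for P
  proof (rule finite_subset)
    show "H P \<subseteq> H (\<lambda>_ _ _ _. True)" by (auto simp: H_def)
    show "finite (H (\<lambda>_ _ _ _. True))" using bij_betw_finite[OF b1] finite_odd_squares by blast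
  qed
  have split: "card (H P) = card (H (\<lambda>p q r s. P p q r s \<and> Q p q r s)) + card (H (\<lambda>p q r s. P p q r s \<and> \<not> Q p q r s))" for P Q
  proof -
    have un: "H (\<lambda>p q r s. P p q r s \<and> Q p q r s) \<union> H (\<lambda>p q r s. P p q r s \<and> \<not> Q p q r s) = H P"
      and disj: "H (\<lambda>p q r s. P p q r s \<and> Q p q r s) \<inter> H (\<lambda>p q r s. P p q r s \<and> \<not> Q p q r s) = {}"
      by (auto simp: H_def)
    show ?thesis using card_Un_disjoint[OF fin fin disj] unfolding un .
  qed
  \<comment> \<open>The conjunct \<open>True\<close> reproduces the shape in which
    \<open>split\<close> returns its two parts.\<close>
  have "bij_betw (\<lambda>(p, q, r, s). (q, p, r, s)) (H (\<lambda>p q r s. True \<and> \<not> odd p)) (H (\<lambda>p q r s. True \<and> odd p))"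
    by (rule bij_betw_byWitness[where f' = "\<lambda>(p, q, r, s). (q, p, r, s)"]) (auto simp: H_def)
  then have c1: "card (H (\<lambda>_ _ _ _. True)) = 2 * card (H (\<lambda>p q r s. True \<and> odd p))"
    using split[of "\<lambda>_ _ _ _. True" "\<lambda>p q r s. odd p"] by (simp add: bij_betw_same_card)
  have "bij_betw (\<lambda>(p, q, r, s). (p, q, s, r)) (H (\<lambda>p q r s. (True \<and> odd p) \<and> \<not> odd r)) (H (\<lambda>p q r s. (True \<and> odd p) \<and> odd r))"
    by (rule bij_betw_byWitness[where f' = "\<lambda>(p, q, r, s). (p, q, s, r)"]) (auto simp: H_def)
  then have c2: "card (H (\<lambda>p q r s. True \<and> odd p)) = 2 * card (H (\<lambda>p q r s. (True \<and> odd p) \<and> odd r))"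
    using split[of "\<lambda>p q r s. True \<and> odd p" "\<lambda>p q r s. odd r"] by (simp add: bij_betw_same_card)
  have b3: "bij_betw (\<lambda>(w, a, b, c). (a, c, b, 2 * w)) (quaternary M) (H (\<lambda>p q r s. (True \<and> odd p) \<and> odd r))"
    by (rule bij_betw_byWitness[where f' = "\<lambda>(p, q, r, s). (s div 2, p, r, q)"])
       (auto simp: H_def quaternary_iff elim!: evenE)
  show "card (odd_squares (4 * M)) = 4 * card (quaternary M)"
    using c1 c2 bij_betw_same_card[OF b1] bij_betw_same_card[OF b3] by simp
  show "finite (quaternary M)" using bij_betw_finite[OF b3] fin by blast
qed

section \<open>Comparing the two counts fibre by fibre\<close>

lemma card_fibers:
  fixes X :: "int \<Rightarrow> 'a set"
  assumes "finite {(w, t). t \<in> X (M - 2 * w\<^sup>2)}" and "\<And>j. j < 0 \<Longrightarrow> X j = {}" and "0 < M"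
  shows "card {(w, t). t \<in> X (M - 2 * w\<^sup>2)} = (\<Sum>w\<in>{-M..M}. card (X (M - 2 * w\<^sup>2)))"
proof -
  have "{(w, t). t \<in> X (M - 2 * w\<^sup>2)} = (SIGMA w:{-M..M}. X (M - 2 * w\<^sup>2))"
  proof -
    \<comment> \<open>A nonempty fibre needs 2w^2 <= M, and |w| <= w^2.\<close>
    have "w \<in> {-M..M}" if "t \<in> X (M - 2 * w\<^sup>2)" for w t
    proof -
      have "\<not> M - 2 * w\<^sup>2 < 0" using that assms(2) by blast
      then show ?thesis using abs_le_square[of w] by simp linarith
    qed
    then show ?thesis by blast
  qed
  moreover have "finite (X (M - 2 * w\<^sup>2))" for w
  proof -
    have "Pair w ` X (M - 2 * w\<^sup>2) \<subseteq> {(w, t). t \<in> X (M - 2 * w\<^sup>2)}" by auto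
    then have "finite (Pair w ` X (M - 2 * w\<^sup>2))" using assms(1) finite_subset by blast
    then show ?thesis by (rule finite_imageD) (simp add: inj_on_def)
  qed
  ultimately show ?thesis by (simp add: card_SigmaI)
qed

lemma triples_neg:
  assumes "j < 0"
  shows "triples j = {}"
proof -
  have "p \<notin> triples j" for p
  proof
    assume p: "p \<in> triples j"
    obtain x y z where "p = (x, y, z)" by (cases p)
    with p have v: "0 \<le> x" "0 < y" "0 < z" "x * y + y * z + z * x = 2 * j" by (auto simp: triples_def)
    have "0 \<le> x * y" "0 \<le> y * z" "0 \<le> z * x" using v(1-3) by simp_all
    then show False using v(4) assms by linarith
  qed
  then show ?thesis by blast
qed

lemma ternary_neg:
  assumes "j < 0"
  shows "ternary j = {}"
proof -
  have "p \<notin> ternary j" for p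
  proof
    assume p: "p \<in> ternary j"
    obtain a b c where "p = (a, b, c)" by (cases p)
    with p have v: "a\<^sup>2 + b\<^sup>2 + c\<^sup>2 = 2 * j" by (auto simp: ternary_def)
    have "0 \<le> a\<^sup>2" "0 \<le> b\<^sup>2" "0 \<le> c\<^sup>2" by simp_all
    then show False using v assms by linarith
  qed
  then show ?thesis by blast
qed

lemma card_ternary:
  assumes "odd m" "0 < m"
  shows "card (ternary m) = 4 * card (triples m)"
  using assms
proof (induction "nat m" arbitrary: m rule: less_induct)
  case less
  have sh: "{(w, t). t \<in> triples (m - 2 * w\<^sup>2)} = shifted m" and qu: "{(w, t). t \<in> ternary (m - 2 * w\<^sup>2)} = quaternary m"
    by (simp_all add: shifted_def quaternary_def)
  have "int (4 * card (quaternary m)) = 16 * sigma m"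
    using card_four_odd_squares[OF less.prems] card_quaternary(1)[of m] by simp
  then have "int (card (quaternary m)) = int (4 * card (shifted m))"
    using card_shifted(2)[OF less.prems(1)] by simp
  then have "card (quaternary m) = 4 * card (shifted m)" by linarith
  then have eq: "(\<Sum>w\<in>{-m..m}. card (ternary (m - 2 * w\<^sup>2))) = (\<Sum>w\<in>{-m..m}. 4 * card (triples (m - 2 * w\<^sup>2)))"
    using card_fibers[of triples m, unfolded sh, OF card_shifted(1)[OF less.prems(1)] triples_neg less.prems(2)]
      card_fibers[of ternary m, unfolded qu, OF card_quaternary(2) ternary_neg less.prems(2)]
    by (simp add: sum_distrib_left)
  have "card (ternary (m - 2 * w\<^sup>2)) = 4 * card (triples (m - 2 * w\<^sup>2))" if w: "w \<in> {-m..m} - {0}" for w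
  proof (cases "0 < m - 2 * w\<^sup>2")
    case True
    have "0 < w\<^sup>2" using w by simp
    then show ?thesis using True less.prems by (intro less.hyps) auto
  next
    case False
    \<comment> \<open>The argument stays odd, so it is never 0, and at negative arguments both sets
      are empty.\<close>
    moreover have "odd (m - 2 * w\<^sup>2)" using less.prems by simp
    then have "m - 2 * w\<^sup>2 \<noteq> 0" by auto
    ultimately have "m - 2 * w\<^sup>2 < 0" by linarith
    then show ?thesis by (simp only: triples_neg ternary_neg card.empty mult_0_right)
  qed
  then have "(\<Sum>w\<in>{-m..m} - {0}. card (ternary (m - 2 * w\<^sup>2))) = (\<Sum>w\<in>{-m..m} - {0}. 4 * card (triples (m - 2 * w\<^sup>2)))"
    by (rule sum.cong[OF refl])
  moreover have "0 \<in> {-m..m}" using less.prems by simp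
  ultimately show ?case
    using eq sum.remove[of "{-m..m}" 0 "\<lambda>w. card (ternary (m - 2 * w\<^sup>2))"]
      sum.remove[of "{-m..m}" 0 "\<lambda>w. 4 * card (triples (m - 2 * w\<^sup>2))"] by simp
qed

lemma three_squares:
  fixes m :: int
  assumes "odd m" "0 < m"
  shows "\<exists>a b c. odd a \<and> odd b \<and> even c \<and> a\<^sup>2 + b\<^sup>2 + c\<^sup>2 = 2 * m"
proof -
  have "(0, m, 2) \<in> triples m" using assms by (simp add: triples_def)
  \<comment> \<open>An infinite set would have \<open>card\<close> 0, so a member alone does not
    make the cardinality positive.\<close>
  moreover have "finite (triples m)"
  proof (rule finite_subset)
    have "(0, p) \<in> shifted m" if "p \<in> triples m" for p using that by (simp add: shifted_def)
    then show "triples m \<subseteq> snd ` shifted m" by (metis image_eqI snd_conv subsetI)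
  qed (use card_shifted(1)[OF assms(1)] in simp)
  ultimately have "card (triples m) \<noteq> 0" by auto
  then have "card (ternary m) \<noteq> 0" using card_ternary[OF assms] by simp
  then have "ternary m \<noteq> {}" by auto
  then show ?thesis by (auto simp: ternary_def)
qed

section \<open>From three squares to the quaternary form\<close>

lemma square_mod_3: "(n::int)\<^sup>2 mod 3 = (if n mod 3 = 0 then 0 else 1)"
proof -
  have "n\<^sup>2 mod 3 = (n mod 3)\<^sup>2 mod 3" by (simp add: power_mod)
  moreover have "n mod 3 = 0 \<or> n mod 3 = 1 \<or> n mod 3 = 2" by presburger
  ultimately show ?thesis by auto
qed

text \<open>The substitution A = x + 2y + 3z, B = x + 2y - 3z, C = 2x - 2y turns A^2 + B^2 + C^2
  into 6(x^2 + 2y^2 + 3z^2). To invert it over the integers, 6 must divide A - B and A + B - C. The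
  parities give the factor 2. For the factor 3: squares are 0 or 1 modulo 3, so all or none of A, B,
  C are divisible by 3, and changing the signs of B and C suffices.\<close>

lemma represented_123:
  fixes m :: int
  assumes "odd m" "0 < m"
  shows "\<exists>x y z. m = x\<^sup>2 + 2 * y\<^sup>2 + 3 * z\<^sup>2"
proof -
  obtain A B C where v: "odd A" "odd B" "even C" "A\<^sup>2 + B\<^sup>2 + C\<^sup>2 = 2 * (3 * m)"
    using three_squares[of "3 * m"] assms by auto
  have "(p mod 3 + q mod 3 + r mod 3) mod 3 = (p + q + r) mod 3" for p q r :: int by presburger
  then have "(A\<^sup>2 mod 3 + B\<^sup>2 mod 3 + C\<^sup>2 mod 3) mod 3 = (A\<^sup>2 + B\<^sup>2 + C\<^sup>2) mod 3" .
  also have "\<dots> = 0" unfolding v(4) by presburger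
  finally have "(A\<^sup>2 mod 3 + B\<^sup>2 mod 3 + C\<^sup>2 mod 3) mod 3 = 0" .
  then have m3: "A mod 3 = 0 \<and> B mod 3 = 0 \<and> C mod 3 = 0 \<or> A mod 3 \<noteq> 0 \<and> B mod 3 \<noteq> 0 \<and> C mod 3 \<noteq> 0"
    by (auto simp: square_mod_3 split: if_splits)
  have dvd6: "6 dvd u" if "2 dvd u" "3 dvd u" for u :: int using that by presburger
  obtain B' where B': "B' = B \<or> B' = - B" "6 dvd A - B'"
  proof -
    have "3 dvd A - B \<or> 3 dvd A - (- B)" using m3 by presburger
    moreover have "2 dvd A - B" "2 dvd A - (- B)" using v(1,2) by simp_all
    ultimately have "6 dvd A - B \<or> 6 dvd A - (- B)" using dvd6 by blast
    then show thesis using that by blast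
  qed
  obtain C' where C': "C' = C \<or> C' = - C" "6 dvd A + B' - C'"
  proof -
    have "odd B'" using B'(1) v(2) by auto
    then have "2 dvd A + B' - C" "2 dvd A + B' - (- C)" using v(1,3) by simp_all
    moreover have "3 dvd A - B'" using B'(2) by presburger
    then have "3 dvd A + B' - C \<or> 3 dvd A + B' - (- C)" using m3 by presburger
    ultimately have "6 dvd A + B' - C \<or> 6 dvd A + B' - (- C)" using dvd6 by blast
    then show thesis using that by blast
  qed
  obtain y z where "A - B' = 6 * z" "A + B' - C' = 6 * y" using B'(2) C'(2) by (metis dvdE)
  then have A: "A = B' + 6 * z" and C: "C' = 2 * B' + 6 * z - 6 * y" by auto
  have "A\<^sup>2 + B'\<^sup>2 + C'\<^sup>2 = 6 * m" using v(4) B'(1) C'(1) by auto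
  then have "6 * m = 6 * ((B' + 3 * z - 2 * y)\<^sup>2 + 2 * y\<^sup>2 + 3 * z\<^sup>2)"
    unfolding A C by (simp add: power2_eq_square algebra_simps)
  then have "m = (B' + 3 * z - 2 * y)\<^sup>2 + 2 * y\<^sup>2 + 3 * z\<^sup>2" by simp
  then show ?thesis by blast
qed

text \<open>Even numbers need w: for instance, 10 is not of the form x^2 + 2y^2 + 3z^2. The
  reduction to a positive odd n - 9 leaves the even n below 9, which are listed.\<close>

lemma universal_12:
  assumes "0 \<le> n"
  shows "represents3 1 2 n"
proof (cases "odd n")
  case True
  then have "0 < n" using assms by (cases "n = 0") auto
  then obtain x y z where "n = x\<^sup>2 + 2 * y\<^sup>2 + 3 * z\<^sup>2" using represented_123 True by blast
  then have "f3 1 2 x y z 0 = n" by (simp add: f3_def)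
  then show ?thesis unfolding represents3_def by blast
next
  case False
  show ?thesis
  proof (cases "n < 9")
    case True
    then have "n = 0 \<or> n = 2 \<or> n = 4 \<or> n = 6 \<or> n = 8" using assms False by presburger
    moreover have "f3 1 2 0 0 0 0 = 0" "f3 1 2 0 1 0 0 = 2" "f3 1 2 2 0 0 0 = 4" "f3 1 2 2 1 0 0 = 6" "f3 1 2 0 2 0 0 = 8"
      by (simp_all add: f3_def)
    ultimately show ?thesis unfolding represents3_def by metis
  next
    case False
    then have "odd (n - 9)" "0 < n - 9" using \<open>\<not> odd n\<close> by (auto simp: order_less_le)
    then obtain x y z where "n - 9 = x\<^sup>2 + 2 * y\<^sup>2 + 3 * z\<^sup>2" using represented_123 by blast
    then have "f3 1 2 x y (z - 1) 2 = n" by (simp add: f3_def power2_eq_square algebra_simps)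
    then show ?thesis unfolding represents3_def by blast
  qed
qed

section \<open>The coefficients forced by the values 1, 2 and 6\<close>

lemma eisenstein_nonneg: "0 \<le> (z::int)\<^sup>2 + z * w + w\<^sup>2"
proof -
  have "0 \<le> (2 * z + w)\<^sup>2 + 3 * w\<^sup>2" by simp
  also have "\<dots> = 4 * (z\<^sup>2 + z * w + w\<^sup>2)" by (simp add: power2_eq_square algebra_simps)
  finally show ?thesis by simp
qed

text \<open>An even value forces z and w to be even, because z^2 + zw + w^2 is odd as soon as one of
  them is; an even value is then divisible by 4.\<close>

lemma eisenstein_neq_2: "(z::int)\<^sup>2 + z * w + w\<^sup>2 \<noteq> 2"
proof
  assume eq: "z\<^sup>2 + z * w + w\<^sup>2 = 2"
  then have "even (z\<^sup>2 + z * w + w\<^sup>2)" by simp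
  then have "even z \<and> even w" by auto
  then obtain i j where "z = 2 * i" "w = 2 * j" by (metis evenE)
  then have "4 * (i\<^sup>2 + i * j + j\<^sup>2) = 2" using eq by (simp add: power2_eq_square)
  then show False by presburger
qed

theorem theorem5p4:
  fixes a b :: int
  assumes "0 < a" and "a \<le> b"
    and "represents3 a b 1" and "represents3 a b 2" and "represents3 a b 6"
  shows "\<forall>n::int. n \<ge> 0 \<longrightarrow> represents3 a b n"
proof -
  have coef_le: "c \<le> c * x\<^sup>2" if "0 < c" "x \<noteq> 0" for c x :: int
    using factor_le_mult[OF that(1), of "x\<^sup>2"] that by simp
  have a: "a = 1"
  proof -
    obtain x y z w where eq: "a * x\<^sup>2 + b * y\<^sup>2 + 3 * (z\<^sup>2 + z * w + w\<^sup>2) = 1"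
      using assms(3) by (auto simp: represents3_def f3_def)
    have nn: "0 \<le> a * x\<^sup>2" "0 \<le> b * y\<^sup>2" using assms by simp_all
    show ?thesis
    proof (cases "x = 0 \<and> y = 0")
      case True
      then have "3 * (z\<^sup>2 + z * w + w\<^sup>2) = 1" using eq by simp
      then show ?thesis by presburger
    next
      case False
      then have "a \<le> a * x\<^sup>2 \<or> b \<le> b * y\<^sup>2" using coef_le assms by auto
      \<comment> \<open>The variables p, q, e stand for the nonlinear terms, so that only linear
        arithmetic is left.\<close>
      moreover have "a \<le> 1" if "a \<le> p \<or> b \<le> q" "p + q + 3 * e = 1" "0 \<le> p" "0 \<le> q" "0 \<le> e" for p q e
        using that assms(2) by linarith
      ultimately have "a \<le> 1" using eq nn eisenstein_nonneg by blast
      then show ?thesis using assms(1) by simp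
    qed
  qed
  have b: "b \<le> 2"
  proof -
    obtain x y z w where eq: "x\<^sup>2 + b * y\<^sup>2 + 3 * (z\<^sup>2 + z * w + w\<^sup>2) = 2"
      using assms(4) by (auto simp: represents3_def f3_def a)
    \<comment> \<open>Without y the value 2 would require a square that is 2 modulo 3.\<close>
    have "y \<noteq> 0"
    proof
      assume "y = 0"
      then have "x\<^sup>2 = 2 - 3 * (z\<^sup>2 + z * w + w\<^sup>2)" using eq by simp
      then have "x\<^sup>2 mod 3 = 2" by presburger
      then show False by (simp add: square_mod_3 split: if_splits)
    qed
    then have "b \<le> b * y\<^sup>2" using coef_le assms by auto
    moreover have "0 \<le> x\<^sup>2" by simp
    moreover have "b \<le> 2" if "b \<le> q" "p + q + 3 * e = 2" "0 \<le> p" "0 \<le> e" for p q e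
      using that by linarith
    ultimately show ?thesis using eq eisenstein_nonneg by blast
  qed
  \<comment> \<open>For b = 1 the value 6 requires 3 | x^2 + y^2, hence 3 | x and 3 | y. Dividing by
    3 leaves 3(i^2 + j^2) + (z^2 + zw + w^2) = 2, which makes z^2 + zw + w^2 equal to 2.\<close>
  have "b \<noteq> 1"
  proof
    assume "b = 1"
    then obtain x y z w :: int where eq: "x\<^sup>2 + y\<^sup>2 + 3 * (z\<^sup>2 + z * w + w\<^sup>2) = 6"
      using assms(5) by (auto simp: represents3_def f3_def a)
    then have "(x\<^sup>2 + y\<^sup>2) mod 3 = 0" by presburger
    then have "(x\<^sup>2 mod 3 + y\<^sup>2 mod 3) mod 3 = 0" by (simp add: mod_simps)
    then have "x mod 3 = 0" "y mod 3 = 0" by (auto simp: square_mod_3 split: if_splits)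
    then obtain i j where ij: "x = 3 * i" "y = 3 * j" by (metis mod_0_imp_dvd dvdE)
    have "3 * (i\<^sup>2 + j\<^sup>2) + (z\<^sup>2 + z * w + w\<^sup>2) = 2"
      using eq by (simp add: ij power2_eq_square)
    moreover have "0 \<le> i\<^sup>2 + j\<^sup>2" by simp
    moreover have "u = 2" if "3 * t + u = 2" "0 \<le> t" "0 \<le> u" for t u :: int using that by presburger
    ultimately have "z\<^sup>2 + z * w + w\<^sup>2 = 2" using eisenstein_nonneg[of z w] by blast
    then show False using eisenstein_neq_2 by blast
  qed
  then have "b = 2" using a b assms(2) by simp
  then show ?thesis using universal_12 by (simp add: a)
qed

end
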